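(* Let $\mathbb X=(X,\tau,\mathsf d,\mathfrak m)$ be an extended metric-topological measure space such that $\mathfrak m$ is separable. Then $$\mathrm{Der}^\infty_1(\mathbb X)\subseteq\mathscr X(\mathbb X)$$ and $|b|_W\leq|b|$ holds $\mathfrak m$-a.e. on $X$ for every $b\in\mathrm{Der}^\infty_1(\mathbb X)$. Assuming in addition that $\tau$ is metrisable on all $\tau$-compact subsets of $X$, we also have that $$\mathscr X(\mathbb X)\subseteq\mathrm{Der}^\infty(\mathbb X)$$ and $|b|_W=|b|$ holds $\mathfrak m$-a.e. on $X$ for every $b\in\mathscr X(\mathbb X)$.
   Context: An extended distance on a set $X$ is a symmetric function $\mathsf d\colon X\times X\to[0,+\infty]$ satisfying the triangle inequality and with $\mathsf d(x,y)=0$ iff $x=y$. For $f\colon X\to\mathbb R$ and $A\subseteq X$, $\mathrm{Lip}(f,A,\mathsf d)=\sup\{|f(x)-f(y)|/\mathsf d(x,y):x,y\in A,\ x\neq y\}$ (with $c/(+\infty)=0$, $\sup\varnothing=0$), $\mathrm{Lip}(f,\mathsf d)=\mathrm{Lip}(f,X,\mathsf d)$. $\mathrm{Lip}_b(X,\tau,\mathsf d)$ is the Banach algebra of bounded $\tau$-continuous $\mathsf d$-Lipschitz functions $f\colon X\to\mathbb R$ with norm $\|f\|_{\mathrm{Lip}_b(X,\tau,\mathsf d)}=\mathrm{Lip}(f,\mathsf d)+\sup_X|f|$. $(X,\tau,\mathsf d)$ is an extended metric-topological space if $\tau$ is Hausdorff, $\mathsf d$ is an extended distance, $\tau$ is the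 initial topology of $\mathrm{Lip}_b(X,\tau,\mathsf d)$, and $\mathsf d(x,y)=\sup\{|f(x)-f(y)|:f\in\mathrm{Lip}_b(X,\tau,\mathsf d),\ \mathrm{Lip}(f,\mathsf d)\leq 1\}$ for all $x,y$. It becomes an extended metric-topological measure space when equipped with a finite Radon (inner regular with respect to $\tau$-compact sets) measure $\mathfrak m$ on the Borel sets of $\tau$. The measure $\mathfrak m$ is separable if there is a countable family $\mathcal C$ of Borel sets such that for every Borel $E$ and $\varepsilon>0$ there is $F\in\mathcal C$ with $\mathfrak m(E\Delta F)<\varepsilon$. The asymptotic slope of $f\in\mathrm{Lip}_b(X,\tau,\mathsf d)$ is $\mathrm{lip}_{\mathsf d}(f)(x)=\inf\{\mathrm{Lip}(f,U,\mathsf d):x\in U\in\tau\}$. $L^0(\mathfrak m)$ is the algebra of real-valued $\tau$-Borel functions up to $\mathfrak m$-a.e. equality; a superscript $+$ denotes nonnegative elements; $\bigwedge$ denotes the $\mathfrak m$-essential infimum. A Lipschitz derivation on $\mathbb X$ is a linear map $b\colon\mathrm{Lip}_b(X,\tau,\mathsf d)\to L^0(\mathfrak m)$ with $b(fg)=f\,b(g)+g\,b(f)$ for all $f,g$. It has divergence if $b(f)\in L^1(\mathfrak m)$ for every $f$ and there is a (unique) $\mathrm{div}(b)\in L^1(\mathfrak m)$ with $\int b(f)\,d\mathfrak m=-\int f\,\mathrm{div}(b)\,d\mathfrak m$ for every $f\in\mathrm{Lip}_b(X,\tau,\mathsf d)$. Weaver derivations: $\mathscr X(\mathbb X)$ is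 the set of Lipschitz derivations $b$ such that $b(f)\in L^\infty(\mathfrak m)$ for every $f$ and the restriction of $b$ to the closed unit ball of $\mathrm{Lip}_b(X,\tau,\mathsf d)$ is sequentially continuous from the topology of pointwise convergence to the weak$^*$ topology of $L^\infty(\mathfrak m)$. For $b\in\mathscr X(\mathbb X)$, $|b|_W=\bigwedge\{g\in L^\infty(\mathfrak m)^+:|b(f)|\leq g\|f\|_{\mathrm{Lip}_b(X,\tau,\mathsf d)}\ \mathfrak m\text{-a.e. for every }f\in\mathrm{Lip}_b(X,\tau,\mathsf d)\}$. Di Marino derivations: $\mathrm{Der}^0(\mathbb X)$ is the set of Lipschitz derivations $b$ for which there is $g\in L^0(\mathfrak m)^+$ with ( * ) $|b(f)|\leq g\,\mathrm{lip}_{\mathsf d}(f)$ $\mathfrak m$-a.e. for every $f\in\mathrm{Lip}_b(X,\tau,\mathsf d)$; $|b|=\bigwedge\{g\in L^0(\mathfrak m)^+:( * )\text{ holds}\}$. $\mathrm{Der}^\infty(\mathbb X)$ is the set of $b\in\mathrm{Der}^0(\mathbb X)$ with $|b|\in L^\infty(\mathfrak m)$, and $\mathrm{Der}^\infty_1(\mathbb X)$ is the set of $b\in\mathrm{Der}^\infty(\mathbb X)$ having divergence (which lies in $L^1(\mathfrak m)$). *)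

theory Defs
  imports "HOL-Analysis.Analysis"
begin

text \<open>
  The underlying set is a type \<open>'a\<close>, and the topology is the one of its type class; Hausdorffness
  is the class \<open>t2_space\<close>.  Throughout, \<open>d\<close> is an extended distance and \<open>M\<close> a
  measure on the Borel sets.
\<close>

definition extended_distance :: "('a \<Rightarrow> 'a \<Rightarrow> ennreal) \<Rightarrow> bool" where
  "extended_distance d \<longleftrightarrow>
     (\<forall>x y. d x y = d y x) \<and>
     (\<forall>x y z. d x z \<le> d x y + d y z) \<and>
     (\<forall>x y. d x y = 0 \<longleftrightarrow> x = y)"

text \<open>In \<^typ>\<open>ennreal\<close>, a finite number divided by \<open>\<infinity>\<close> is \<open>0\<close> and the
  supremum of the empty set is \<open>0\<close>, as required.\<close>

definition Lip :: "('a \<Rightarrow> 'a \<Rightarrow> ennreal) \<Rightarrow> 'a set \<Rightarrow> ('a \<Rightarrow> real) \<Rightarrow> ennreal" where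
  "Lip d A f = Sup {ennreal \<bar>f x - f y\<bar> / d x y | x y. x \<in> A \<and> y \<in> A \<and> x \<noteq> y}"

definition Lipb :: "('a::topological_space \<Rightarrow> 'a \<Rightarrow> ennreal) \<Rightarrow> ('a \<Rightarrow> real) set" where
  "Lipb d = {f. bounded (range f) \<and> continuous_on UNIV f \<and> Lip d UNIV f < \<infinity>}"

definition Lipb_norm :: "('a \<Rightarrow> 'a \<Rightarrow> ennreal) \<Rightarrow> ('a \<Rightarrow> real) \<Rightarrow> real" where
  "Lipb_norm d f = enn2real (Lip d UNIV f) + (SUP x. \<bar>f x\<bar>)"

definition ext_metric_top_space :: "('a::t2_space \<Rightarrow> 'a \<Rightarrow> ennreal) \<Rightarrow> bool" where
  "ext_metric_top_space d \<longleftrightarrow>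
     extended_distance d \<and>
     (\<forall>U::'a set. open U \<longleftrightarrow>
        generate_topology {f -` V | f V. f \<in> Lipb d \<and> open V} U) \<and>
     (\<forall>x y. d x y = (SUP f\<in>{f \<in> Lipb d. Lip d UNIV f \<le> 1}. ennreal \<bar>f x - f y\<bar>))"

definition finite_Radon_measure :: "'a::t2_space measure \<Rightarrow> bool" where
  "finite_Radon_measure M \<longleftrightarrow>
     sets M = sets borel \<and> finite_measure M \<and>
     (\<forall>B\<in>sets M. emeasure M B = (SUP K\<in>{K. compact K \<and> K \<subseteq> B}. emeasure M K))"

definition ext_metric_top_measure_space ::
    "('a::t2_space \<Rightarrow> 'a \<Rightarrow> ennreal) \<Rightarrow> 'a measure \<Rightarrow> bool" where
  "ext_metric_top_measure_space d M \<longleftrightarrow> ext_metric_top_space d \<and> finite_Radon_measure M"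

definition separable_measure :: "'a measure \<Rightarrow> bool" where
  "separable_measure M \<longleftrightarrow>
     (\<exists>C. countable C \<and> C \<subseteq> sets M \<and>
        (\<forall>E\<in>sets M. \<forall>\<epsilon>>0. \<exists>F\<in>C. measure M ((E - F) \<union> (F - E)) < \<epsilon>))"

text \<open>The infimum is finite for \<open>f \<in> Lipb d\<close>, so \<^const>\<open>enn2real\<close> loses nothing there.\<close>

definition asymp_slope :: "('a::topological_space \<Rightarrow> 'a \<Rightarrow> ennreal) \<Rightarrow> ('a \<Rightarrow> real) \<Rightarrow> 'a \<Rightarrow> real" where
  "asymp_slope d f x = enn2real (INF U\<in>{U. open U \<and> x \<in> U}. Lip d U f)"

text \<open>
  Elements of \<open>L\<^sup>0\<close>, \<open>L\<^sup>1\<close>, \<open>L\<^sup>\<infinity>\<close> are given by Borel representatives, and all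
  relations between them are required only almost everywhere.  In particular a map from
  \<open>Lipb d\<close> to \<open>L\<^sup>0\<close> is a function \<open>b\<close> selecting a representative of each value; what
  it does outside \<open>Lipb d\<close> is irrelevant.
\<close>

definition L0_plus :: "'a measure \<Rightarrow> ('a \<Rightarrow> real) set" where
  "L0_plus M = {g \<in> borel_measurable M. AE x in M. 0 \<le> g x}"

definition Linf :: "'a measure \<Rightarrow> ('a \<Rightarrow> real) set" where
  "Linf M = {g \<in> borel_measurable M. \<exists>C. AE x in M. \<bar>g x\<bar> \<le> C}"

definition Linf_plus :: "'a measure \<Rightarrow> ('a \<Rightarrow> real) set" where
  "Linf_plus M = {g \<in> Linf M. AE x in M. 0 \<le> g x}"

text \<open>The essential infimum is the greatest lower bound for the a.e. order; it is determined
  up to a.e. equality, and it exists for nonempty families bounded from below.\<close>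

definition is_ess_inf :: "'a measure \<Rightarrow> ('a \<Rightarrow> real) set \<Rightarrow> ('a \<Rightarrow> real) \<Rightarrow> bool" where
  "is_ess_inf M G h \<longleftrightarrow>
     h \<in> borel_measurable M \<and>
     (\<forall>g\<in>G. AE x in M. h x \<le> g x) \<and>
     (\<forall>k\<in>borel_measurable M. (\<forall>g\<in>G. AE x in M. k x \<le> g x) \<longrightarrow> (AE x in M. k x \<le> h x))"

definition ess_inf :: "'a measure \<Rightarrow> ('a \<Rightarrow> real) set \<Rightarrow> 'a \<Rightarrow> real" where
  "ess_inf M G = (SOME h. is_ess_inf M G h)"

text \<open>Convergence of sequences in the weak* topology of \<open>L\<^sup>\<infinity>\<close> as the dual of \<open>L\<^sup>1\<close>.\<close>

definition weak_star_tendsto ::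
    "'a measure \<Rightarrow> (nat \<Rightarrow> 'a \<Rightarrow> real) \<Rightarrow> ('a \<Rightarrow> real) \<Rightarrow> bool" where
  "weak_star_tendsto M h h0 \<longleftrightarrow>
     (\<forall>\<phi>. integrable M \<phi> \<longrightarrow>
        (\<lambda>n. \<integral>x. h n x * \<phi> x \<partial>M) \<longlonglongrightarrow> (\<integral>x. h0 x * \<phi> x \<partial>M))"

definition Lipschitz_derivation ::
    "('a::topological_space \<Rightarrow> 'a \<Rightarrow> ennreal) \<Rightarrow> 'a measure \<Rightarrow>
     (('a \<Rightarrow> real) \<Rightarrow> ('a \<Rightarrow> real)) \<Rightarrow> bool" where
  "Lipschitz_derivation d M b \<longleftrightarrow>
     (\<forall>f\<in>Lipb d. b f \<in> borel_measurable M) \<and>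
     (\<forall>f\<in>Lipb d. \<forall>g\<in>Lipb d. AE x in M. b (\<lambda>y. f y + g y) x = b f x + b g x) \<and>
     (\<forall>c. \<forall>f\<in>Lipb d. AE x in M. b (\<lambda>y. c * f y) x = c * b f x) \<and>
     (\<forall>f\<in>Lipb d. \<forall>g\<in>Lipb d. AE x in M. b (\<lambda>y. f y * g y) x = f x * b g x + g x * b f x)"

definition has_divergence ::
    "('a::topological_space \<Rightarrow> 'a \<Rightarrow> ennreal) \<Rightarrow> 'a measure \<Rightarrow>
     (('a \<Rightarrow> real) \<Rightarrow> ('a \<Rightarrow> real)) \<Rightarrow> bool" where
  "has_divergence d M b \<longleftrightarrow>
     (\<forall>f\<in>Lipb d. integrable M (b f)) \<and>
     (\<exists>D. integrable M D \<and>
        (\<forall>f\<in>Lipb d. (\<integral>x. b f x \<partial>M) = - (\<integral>x. f x * D x \<partial>M)))"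

definition Weaver_derivations ::
    "('a::topological_space \<Rightarrow> 'a \<Rightarrow> ennreal) \<Rightarrow> 'a measure \<Rightarrow>
     (('a \<Rightarrow> real) \<Rightarrow> ('a \<Rightarrow> real)) set" where
  "Weaver_derivations d M =
     {b. Lipschitz_derivation d M b \<and>
         (\<forall>f\<in>Lipb d. b f \<in> Linf M) \<and>
         (\<forall>f f0. (\<forall>n. f n \<in> Lipb d \<and> Lipb_norm d (f n) \<le> 1) \<longrightarrow>
                 f0 \<in> Lipb d \<and> Lipb_norm d f0 \<le> 1 \<longrightarrow>
                 (\<forall>x. (\<lambda>n. f n x) \<longlonglongrightarrow> f0 x) \<longrightarrow>
                 weak_star_tendsto M (\<lambda>n. b (f n)) (b f0))}"

definition Weaver_norm ::
    "('a::topological_space \<Rightarrow> 'a \<Rightarrow> ennreal) \<Rightarrow> 'a measure \<Rightarrow>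
     (('a \<Rightarrow> real) \<Rightarrow> ('a \<Rightarrow> real)) \<Rightarrow> 'a \<Rightarrow> real" where
  "Weaver_norm d M b =
     ess_inf M {g \<in> Linf_plus M. \<forall>f\<in>Lipb d. AE x in M. \<bar>b f x\<bar> \<le> g x * Lipb_norm d f}"

definition slope_bounds ::
    "('a::topological_space \<Rightarrow> 'a \<Rightarrow> ennreal) \<Rightarrow> 'a measure \<Rightarrow>
     (('a \<Rightarrow> real) \<Rightarrow> ('a \<Rightarrow> real)) \<Rightarrow> ('a \<Rightarrow> real) set" where
  "slope_bounds d M b =
     {g \<in> L0_plus M. \<forall>f\<in>Lipb d. AE x in M. \<bar>b f x\<bar> \<le> g x * asymp_slope d f x}"

definition Der0 ::
    "('a::topological_space \<Rightarrow> 'a \<Rightarrow> ennreal) \<Rightarrow> 'a measure \<Rightarrow>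
     (('a \<Rightarrow> real) \<Rightarrow> ('a \<Rightarrow> real)) set" where
  "Der0 d M = {b. Lipschitz_derivation d M b \<and> slope_bounds d M b \<noteq> {}}"

definition Der_norm ::
    "('a::topological_space \<Rightarrow> 'a \<Rightarrow> ennreal) \<Rightarrow> 'a measure \<Rightarrow>
     (('a \<Rightarrow> real) \<Rightarrow> ('a \<Rightarrow> real)) \<Rightarrow> 'a \<Rightarrow> real" where
  "Der_norm d M b = ess_inf M (slope_bounds d M b)"

definition Der_inf ::
    "('a::topological_space \<Rightarrow> 'a \<Rightarrow> ennreal) \<Rightarrow> 'a measure \<Rightarrow>
     (('a \<Rightarrow> real) \<Rightarrow> ('a \<Rightarrow> real)) set" where
  "Der_inf d M = {b \<in> Der0 d M. Der_norm d M b \<in> Linf M}"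

definition Der_inf_1 ::
    "('a::topological_space \<Rightarrow> 'a \<Rightarrow> ennreal) \<Rightarrow> 'a measure \<Rightarrow>
     (('a \<Rightarrow> real) \<Rightarrow> ('a \<Rightarrow> real)) set" where
  "Der_inf_1 d M = {b \<in> Der_inf d M. has_divergence d M b}"

end

theory Submission
  imports Defs
begin

text \<open>
  A bounded Di Marino derivation with divergence is weakly* continuous by integration by parts and
  density of \<open>Lipb d\<close> in \<open>L\<^sup>1\<close>. Conversely, a Weaver derivation is bounded by uniform boundedness
  and is local, and any \<open>f \<in> Lipb d\<close> agrees near \<open>x\<close>, up to an additive constant, with a global
  function whose norm is close to the slope of \<open>f\<close> at \<open>x\<close>; inner regularity of the measure turns the
  resulting local estimates into the pointwise bound by the asymptotic slope.
\<close>

section \<open>Lipschitz functions for an extended distance\<close>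

text \<open>A Weaver derivation is only required to send each single \<open>f\<close> into
  \<open>L^\<infinity>\<close>. Even one \<open>g\<close> admissible for \<open>Weaver_norm\<close>
  must be extracted from continuity along sequences; a gliding hump argument does this, with
  explicit test functions. The global norm contains the supremum of |f|, which the slope does not
  see. Derivations kill constants, so \<open>f - f x\<close> may replace \<open>f\<close>, and
  clamping it at a small height makes the supremum negligible; locality carries the estimate back to
  \<open>f\<close>. The estimate near \<open>x\<close> holds off a null set that depends on
  \<open>x\<close>, and there are uncountably many \<open>x\<close>. Exhausting by compact sets
  leaves countably many null sets. Both pointwise norms are essential infima picked by
  \<open>SOME\<close>. They become usable once the infimum is known to exist and to belong itself to
  the family it bounds. Both families consist of nonnegative functions and are closed under minima,
  which is what the existence proof exploits.\<close>

lemma Lip_le_iff: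
  assumes d: "extended_distance d" and "0 \<le> L"
  shows "Lip d A f \<le> ennreal L \<longleftrightarrow>
    (\<forall>x\<in>A. \<forall>y\<in>A. d x y < top \<longrightarrow> \<bar>f x - f y\<bar> \<le> L * enn2real (d x y))"
proof -
  \<comment> \<open>A pair at infinite distance has quotient 0 and imposes no condition, hence the
    guard \<open>d x y < top\<close>. With it, the division in \<open>ennreal\<close> becomes an
    inequality between reals, the form used from here on.\<close>
  have pt: "ennreal \<bar>f x - f y\<bar> / d x y \<le> ennreal L \<longleftrightarrow>
      (d x y < top \<longrightarrow> \<bar>f x - f y\<bar> \<le> L * enn2real (d x y))" if "x \<noteq> y" for x y
  proof (cases "d x y")
    case (real r)
    have "d x y \<noteq> 0" using d that by (auto simp: extended_distance_def)
    with real have r: "r > 0" by (cases "r = 0") auto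
    have "ennreal \<bar>f x - f y\<bar> / d x y = ennreal (\<bar>f x - f y\<bar> / r)"
      using real r by (simp add: divide_ennreal)
    then show ?thesis using real r \<open>0 \<le> L\<close>
      by (simp add: ennreal_le_iff pos_divide_le_eq)
  qed simp
  have "Lip d A f \<le> ennreal L \<longleftrightarrow>
    (\<forall>x\<in>A. \<forall>y\<in>A. x \<noteq> y \<longrightarrow> ennreal \<bar>f x - f y\<bar> / d x y \<le> ennreal L)"
    unfolding Lip_def by (subst Sup_le_iff) blast
  also have "\<dots> \<longleftrightarrow>
    (\<forall>x\<in>A. \<forall>y\<in>A. d x y < top \<longrightarrow> \<bar>f x - f y\<bar> \<le> L * enn2real (d x y))"
    (is "?lhs = ?rhs")
  proof
    assume ?lhs
    show ?rhs
    proof (intro ballI impI)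
      fix x y assume "x \<in> A" "y \<in> A" "d x y < top"
      with \<open>?lhs\<close> pt[of x y] \<open>0 \<le> L\<close> show "\<bar>f x - f y\<bar> \<le> L * enn2real (d x y)"
        by (cases "x = y") auto
    qed
  qed (use pt in blast)
  finally show ?thesis .
qed

lemma LipbI:
  assumes "extended_distance d" "continuous_on UNIV f" "\<And>x. \<bar>f x\<bar> \<le> B" "0 \<le> L"
    and "\<And>x y. d x y < top \<Longrightarrow> \<bar>f x - f y\<bar> \<le> L * enn2real (d x y)"
  shows "f \<in> Lipb d"
proof -
  have "Lip d UNIV f \<le> ennreal L"
    using assms by (subst Lip_le_iff) auto
  then have "Lip d UNIV f < top" using ennreal_less_top le_less_trans by blast
  moreover have "bounded (range f)"
    using assms(3) by (auto simp: bounded_iff)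
  ultimately show ?thesis using assms(2) by (simp add: Lipb_def)
qed

lemma Lipb_Lip:
  assumes "extended_distance d" "f \<in> Lipb d" "d x y < top"
  shows "\<bar>f x - f y\<bar> \<le> enn2real (Lip d UNIV f) * enn2real (d x y)"
proof -
  have "Lip d UNIV f \<le> ennreal (enn2real (Lip d UNIV f))"
    using assms by (simp add: Lipb_def)
  then show ?thesis using assms Lip_le_iff[of d "enn2real (Lip d UNIV f)" UNIV f] by simp
qed

lemma Lipb_abs_le_SUP:
  assumes "f \<in> Lipb d"
  shows "\<bar>f x\<bar> \<le> (SUP x. \<bar>f x\<bar>)"
proof (rule cSUP_upper)
  obtain B where "\<And>x. \<bar>f x\<bar> \<le> B" using assms by (auto simp: Lipb_def bounded_iff)
  then show "bdd_above (range (\<lambda>x. \<bar>f x\<bar>))" by (intro bdd_aboveI) auto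
qed simp

lemma LipbE:
  assumes "extended_distance d" "f \<in> Lipb d"
  obtains B L where "0 \<le> B" "0 \<le> L" "\<And>x. \<bar>f x\<bar> \<le> B"
    "\<And>x y. d x y < top \<Longrightarrow> \<bar>f x - f y\<bar> \<le> L * enn2real (d x y)" "continuous_on UNIV f"
proof (rule that)
  show "\<bar>f x\<bar> \<le> (SUP x. \<bar>f x\<bar>)" for x by (rule Lipb_abs_le_SUP[OF assms(2)])
  show "0 \<le> (SUP x. \<bar>f x\<bar>)"
    using Lipb_abs_le_SUP[OF assms(2), of undefined] by linarith
  show "\<bar>f x - f y\<bar> \<le> enn2real (Lip d UNIV f) * enn2real (d x y)" if "d x y < top" for x y
    by (rule Lipb_Lip[OF assms that])
qed (use assms in \<open>auto simp: Lipb_def\<close>)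

lemma Lipb_norm_nonneg:
  assumes "f \<in> Lipb d" shows "0 \<le> Lipb_norm d f"
  using Lipb_abs_le_SUP[OF assms, of undefined] enn2real_nonneg[of "Lip d UNIV f"]
  unfolding Lipb_norm_def by linarith

lemma abs_le_Lipb_norm:
  assumes "f \<in> Lipb d" shows "\<bar>f x\<bar> \<le> Lipb_norm d f"
  using Lipb_abs_le_SUP[OF assms, of x] enn2real_nonneg[of "Lip d UNIV f"]
  unfolding Lipb_norm_def by linarith

lemma Lip_le_Lipb_norm:
  assumes "f \<in> Lipb d" shows "enn2real (Lip d UNIV f) \<le> Lipb_norm d f"
  using Lipb_abs_le_SUP[OF assms, of undefined] unfolding Lipb_norm_def by linarith

lemma Lipb_norm_le:
  assumes "extended_distance d" "\<And>x. \<bar>f x\<bar> \<le> B" "0 \<le> L"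
    and "\<And>x y. d x y < top \<Longrightarrow> \<bar>f x - f y\<bar> \<le> L * enn2real (d x y)"
  shows "Lipb_norm d f \<le> L + B"
proof -
  have "Lip d UNIV f \<le> ennreal L"
    using assms by (subst Lip_le_iff) auto
  then have "enn2real (Lip d UNIV f) \<le> L" by (rule enn2real_leI[OF assms(3)])
  moreover have "(SUP x. \<bar>f x\<bar>) \<le> B" by (rule cSUP_least) (use assms(2) in auto)
  ultimately show ?thesis by (simp add: Lipb_norm_def)
qed

lemma Lipb_norm_eq_0:
  assumes "f \<in> Lipb d" "Lipb_norm d f = 0"
  shows "f = (\<lambda>x. 0)"
  using abs_le_Lipb_norm[OF assms(1)] assms(2) by fastforce

section \<open>The algebra \<open>Lipb d\<close> and its stability under Lipschitz maps of the
  line\<close>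

lemma Lipb_const: "extended_distance d \<Longrightarrow> (\<lambda>x. c) \<in> Lipb d"
  by (rule LipbI[where B = "\<bar>c\<bar>" and L = 0]) auto

lemma Lipb_add:
  assumes d: "extended_distance d" and "f \<in> Lipb d" "g \<in> Lipb d"
  shows "(\<lambda>x. f x + g x) \<in> Lipb d"
proof -
  obtain B L where f: "0 \<le> B" "0 \<le> L" "\<And>x. \<bar>f x\<bar> \<le> B"
    "\<And>x y. d x y < top \<Longrightarrow> \<bar>f x - f y\<bar> \<le> L * enn2real (d x y)" "continuous_on UNIV f"
    using LipbE[OF d \<open>f \<in> Lipb d\<close>] by metis
  obtain B' L' where g: "0 \<le> B'" "0 \<le> L'" "\<And>x. \<bar>g x\<bar> \<le> B'"
    "\<And>x y. d x y < top \<Longrightarrow> \<bar>g x - g y\<bar> \<le> L' * enn2real (d x y)" "continuous_on UNIV g"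
    using LipbE[OF d \<open>g \<in> Lipb d\<close>] by metis
  show ?thesis
  proof (rule LipbI[OF d, where B = "B + B'" and L = "L + L'"])
    show "\<bar>f x + g x\<bar> \<le> B + B'" for x using f(3)[of x] g(3)[of x] by linarith
    show "\<bar>f x + g x - (f y + g y)\<bar> \<le> (L + L') * enn2real (d x y)" if "d x y < top" for x y
      using f(4)[OF that] g(4)[OF that] unfolding distrib_right by linarith
  qed (use f g in \<open>auto intro: continuous_intros\<close>)
qed

lemma Lipb_mult:
  assumes d: "extended_distance d" and "f \<in> Lipb d" "g \<in> Lipb d"
  shows "(\<lambda>x. f x * g x) \<in> Lipb d"
proof -
  obtain B L where f: "0 \<le> B" "0 \<le> L" "\<And>x. \<bar>f x\<bar> \<le> B"
    "\<And>x y. d x y < top \<Longrightarrow> \<bar>f x - f y\<bar> \<le> L * enn2real (d x y)" "continuous_on UNIV f"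
    using LipbE[OF d \<open>f \<in> Lipb d\<close>] by metis
  obtain B' L' where g: "0 \<le> B'" "0 \<le> L'" "\<And>x. \<bar>g x\<bar> \<le> B'"
    "\<And>x y. d x y < top \<Longrightarrow> \<bar>g x - g y\<bar> \<le> L' * enn2real (d x y)" "continuous_on UNIV g"
    using LipbE[OF d \<open>g \<in> Lipb d\<close>] by metis
  show ?thesis
  proof (rule LipbI[OF d, where B = "B * B'" and L = "B * L' + B' * L"])
    show "\<bar>f x * g x\<bar> \<le> B * B'" for x
      unfolding abs_mult by (intro mult_mono f g) (use f g in auto)
    show "\<bar>f x * g x - f y * g y\<bar> \<le> (B * L' + B' * L) * enn2real (d x y)" if "d x y < top" for x y
    proof -
      have "f x * g x - f y * g y = f x * (g x - g y) + g y * (f x - f y)"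
        by (simp add: algebra_simps)
      also have "\<bar>\<dots>\<bar> \<le> \<bar>f x\<bar> * \<bar>g x - g y\<bar> + \<bar>g y\<bar> * \<bar>f x - f y\<bar>"
        unfolding abs_mult[symmetric] by (rule abs_triangle_ineq)
      also have "\<dots> \<le> B * (L' * enn2real (d x y)) + B' * (L * enn2real (d x y))"
        by (intro add_mono mult_mono f g that) (use f g in auto)
      finally show ?thesis by (simp add: algebra_simps)
    qed
  qed (use f g in \<open>auto intro: continuous_intros\<close>)
qed

lemma Lipb_cmult: "extended_distance d \<Longrightarrow> f \<in> Lipb d \<Longrightarrow> (\<lambda>x. c * f x) \<in> Lipb d"
  using Lipb_mult[OF _ Lipb_const] by blast

lemma Lipb_diff:
  assumes "extended_distance d" "f \<in> Lipb d" "g \<in> Lipb d"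
  shows "(\<lambda>x. f x - g x) \<in> Lipb d"
  using Lipb_add[OF assms(1,2) Lipb_cmult[OF assms(1,3), of "-1"]] by simp

lemma Lipb_sum:
  assumes d: "extended_distance d" and "\<And>i. i \<in> I \<Longrightarrow> f i \<in> Lipb d"
  shows "(\<lambda>x. \<Sum>i\<in>I. f i x) \<in> Lipb d"
  using assms(2)
  by (induction I rule: infinite_finite_induct) (auto intro: Lipb_const Lipb_add d)

lemma Lipb_compose:
  fixes \<phi> :: "real \<Rightarrow> real"
  assumes d: "extended_distance d" and "f \<in> Lipb d"
    and \<phi>: "\<And>s t. \<bar>\<phi> s - \<phi> t\<bar> \<le> C * \<bar>s - t\<bar>"
  shows "(\<lambda>x. \<phi> (f x)) \<in> Lipb d"
proof -
  obtain B L where f: "0 \<le> B" "0 \<le> L" "\<And>x. \<bar>f x\<bar> \<le> B"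
    "\<And>x y. d x y < top \<Longrightarrow> \<bar>f x - f y\<bar> \<le> L * enn2real (d x y)" "continuous_on UNIV f"
    using LipbE[OF d \<open>f \<in> Lipb d\<close>] by metis
  have C: "0 \<le> C" using \<phi>[of 0 1] by simp
  have "C-lipschitz_on UNIV \<phi>"
    by (rule lipschitz_onI) (use \<phi> C in \<open>auto simp: dist_real_def\<close>)
  then have "continuous_on UNIV \<phi>" by (rule lipschitz_on_continuous_on)
  then have cont: "continuous_on UNIV (\<lambda>x. \<phi> (f x))"
    using continuous_on_compose2[OF _ f(5)] by blast
  show ?thesis
  proof (rule LipbI[OF d, where B = "\<bar>\<phi> 0\<bar> + C * B" and L = "C * L"])
    show "\<bar>\<phi> (f x)\<bar> \<le> \<bar>\<phi> 0\<bar> + C * B" for x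
      using \<phi>[of "f x" 0] mult_left_mono[OF f(3)[of x] C] by simp
    show "\<bar>\<phi> (f x) - \<phi> (f y)\<bar> \<le> C * L * enn2real (d x y)" if "d x y < top" for x y
      using \<phi>[of "f x" "f y"] mult_left_mono[OF f(4)[OF that] C] by (simp add: mult.assoc)
  qed (use f cont C in auto)
qed

lemma Lipb_norm_cmult_le:
  assumes d: "extended_distance d" and f: "f \<in> Lipb d"
  shows "Lipb_norm d (\<lambda>x. c * f x) \<le> \<bar>c\<bar> * Lipb_norm d f"
proof -
  have "Lipb_norm d (\<lambda>x. c * f x) \<le> \<bar>c\<bar> * enn2real (Lip d UNIV f) + \<bar>c\<bar> * (SUP x. \<bar>f x\<bar>)"
  proof (rule Lipb_norm_le[OF d])
    show "\<bar>c * f x\<bar> \<le> \<bar>c\<bar> * (SUP x. \<bar>f x\<bar>)" for x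
      unfolding abs_mult by (intro mult_left_mono Lipb_abs_le_SUP[OF f]) auto
    show "\<bar>c * f x - c * f y\<bar> \<le> \<bar>c\<bar> * enn2real (Lip d UNIV f) * enn2real (d x y)"
      if "d x y < top" for x y
    proof -
      have "\<bar>c * f x - c * f y\<bar> = \<bar>c\<bar> * \<bar>f x - f y\<bar>"
        by (simp flip: right_diff_distrib add: abs_mult)
      then show ?thesis using mult_left_mono[OF Lipb_Lip[OF d f that], of "\<bar>c\<bar>"]
        by (simp add: mult.assoc)
    qed
  qed auto
  then show ?thesis by (simp add: Lipb_norm_def distrib_left)
qed

text \<open>The initial topology is used here, by induction on its generation: a tent function
  composed with \<open>f\<close> serves a subbasic set, products serve intersections, and for a
  union the cutoff of one member containing \<open>x\<close> suffices.\<close>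

lemma Lipb_cutoff:
  fixes d :: "'a::t2_space \<Rightarrow> 'a \<Rightarrow> ennreal"
  assumes "ext_metric_top_space d" "open U" "x \<in> U"
  shows "\<exists>\<eta>\<in>Lipb d. \<eta> x = 1 \<and> (\<forall>y. 0 \<le> \<eta> y \<and> \<eta> y \<le> 1) \<and> (\<forall>y. y \<notin> U \<longrightarrow> \<eta> y = 0)"
proof -
  have d: "extended_distance d" using assms by (simp add: ext_metric_top_space_def)
  have "generate_topology {f -` V | f V. f \<in> Lipb d \<and> open V} U"
    using assms by (simp add: ext_metric_top_space_def)
  then show ?thesis using \<open>x \<in> U\<close>
  proof (induction arbitrary: x)
    case UNIV
    show ?case by (rule bexI[OF _ Lipb_const[OF d, of 1]]) auto
  next
    case (Int a b)
    obtain \<eta> where \<eta>: "\<eta> \<in> Lipb d" "\<eta> x = 1"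
      "\<forall>y. 0 \<le> \<eta> y \<and> \<eta> y \<le> 1" "\<forall>y. y \<notin> a \<longrightarrow> \<eta> y = 0"
      using Int.IH(1)[of x] Int.prems by blast
    obtain \<theta> where \<theta>: "\<theta> \<in> Lipb d" "\<theta> x = 1"
      "\<forall>y. 0 \<le> \<theta> y \<and> \<theta> y \<le> 1" "\<forall>y. y \<notin> b \<longrightarrow> \<theta> y = 0"
      using Int.IH(2)[of x] Int.prems by blast
    show ?case
      by (intro bexI[of _ "\<lambda>y. \<eta> y * \<theta> y"] Lipb_mult d) (use \<eta> \<theta> in \<open>auto intro: mult_le_one\<close>)
  next
    case (UN K)
    then obtain k where k: "k \<in> K" "x \<in> k" by blast
    obtain \<eta> where "\<eta> \<in> Lipb d" "\<eta> x = 1"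
      "\<forall>y. 0 \<le> \<eta> y \<and> \<eta> y \<le> 1" "\<forall>y. y \<notin> k \<longrightarrow> \<eta> y = 0"
      using UN.IH[OF k] by blast
    with k show ?case by (intro bexI[of _ \<eta>]) auto
  next
    case (Basis s)
    then obtain f V where f: "s = f -` V" "f \<in> Lipb d" "open V" by blast
    then obtain r where r: "r > 0" "ball (f x) r \<subseteq> V"
      using Basis openE[of V "f x"] by auto
    \<comment> \<open>A tent of height 1 centred at \<open>f x\<close>. Its half-width
      \<open>r\<close> makes it vanish off the ball inside \<open>V\<close> and gives it slope
      \<open>1 / r\<close>.\<close>
    define \<phi> where "\<phi> t = max 0 (1 - (1 / r) * \<bar>t - f x\<bar>)" for t
    have "\<bar>\<phi> s - \<phi> t\<bar> \<le> (1 / r) * \<bar>s - t\<bar>" for s t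
    proof -
      have "\<bar>\<phi> s - \<phi> t\<bar> \<le> \<bar>(1 / r) * \<bar>s - f x\<bar> - (1 / r) * \<bar>t - f x\<bar>\<bar>"
        unfolding \<phi>_def by linarith
      also have "\<dots> = (1 / r) * \<bar>\<bar>s - f x\<bar> - \<bar>t - f x\<bar>\<bar>"
        using r by (simp flip: right_diff_distrib diff_divide_distrib)
      also have "\<dots> \<le> (1 / r) * \<bar>s - t\<bar>"
        by (rule mult_left_mono) (use r in auto)
      finally show ?thesis .
    qed
    then have "(\<lambda>y. \<phi> (f y)) \<in> Lipb d" by (rule Lipb_compose[OF d f(2)])
    moreover have "\<phi> (f y) = 0" if "y \<notin> s" for y
    proof -
      have "f y \<notin> ball (f x) r" using r f that by auto
      then have "r \<le> \<bar>f y - f x\<bar>" by (auto simp: dist_real_def)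
      then show ?thesis using r by (simp add: \<phi>_def field_simps)
    qed
    moreover have "0 \<le> \<phi> t" "\<phi> t \<le> 1" for t using r by (auto simp: \<phi>_def)
    moreover have "\<phi> (f x) = 1" by (simp add: \<phi>_def)
    ultimately show ?case by (intro bexI[of _ "\<lambda>y. \<phi> (f y)"]) auto
  qed
qed

text \<open>Each pointwise cutoff exceeds 1/2 near its centre. Finitely many of these neighbourhoods
  cover \<open>K\<close>, so twice the sum of the cutoffs, truncated at 1, equals 1 on
  \<open>K\<close>.\<close>

lemma Lipb_Urysohn:
  fixes d :: "'a::t2_space \<Rightarrow> 'a \<Rightarrow> ennreal"
  assumes S: "ext_metric_top_space d" and "open U" "compact K" "K \<subseteq> U"
  shows "\<exists>f\<in>Lipb d. (\<forall>x\<in>K. f x = 1) \<and> (\<forall>y. 0 \<le> f y \<and> f y \<le> 1) \<and> (\<forall>y. y \<notin> U \<longrightarrow> f y = 0)"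
proof -
  have d: "extended_distance d" using S by (simp add: ext_metric_top_space_def)
  have "\<exists>\<eta>. \<eta> \<in> Lipb d \<and> \<eta> x = 1 \<and> (\<forall>y. 0 \<le> \<eta> y \<and> \<eta> y \<le> 1) \<and> (\<forall>y. y \<notin> U \<longrightarrow> \<eta> y = 0)"
    if "x \<in> K" for x
    using Lipb_cutoff[OF S \<open>open U\<close>, of x] that assms by blast
  then obtain \<eta> where \<eta>: "\<And>x. x \<in> K \<Longrightarrow> \<eta> x \<in> Lipb d" "\<And>x. x \<in> K \<Longrightarrow> \<eta> x x = 1"
      "\<And>x y. x \<in> K \<Longrightarrow> 0 \<le> \<eta> x y" "\<And>x y. x \<in> K \<Longrightarrow> y \<notin> U \<Longrightarrow> \<eta> x y = 0"
    by metis
  have op: "open (\<eta> x -` {1/2<..})" if "x \<in> K" for x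
    using \<eta>(1)[OF that] by (auto simp: Lipb_def intro!: open_vimage)
  have "K \<subseteq> (\<Union>x\<in>K. \<eta> x -` {1/2<..})" using \<eta>(2) by force
  then obtain C where C: "C \<subseteq> K" "finite C" "K \<subseteq> (\<Union>x\<in>C. \<eta> x -` {1/2<..})"
    using compactE_image[OF \<open>compact K\<close>, of K "\<lambda>x. \<eta> x -` {1/2<..}"] op by metis
  define g where "g y = (\<Sum>x\<in>C. \<eta> x y)" for y
  have "g \<in> Lipb d"
    unfolding g_def by (rule Lipb_sum[OF d]) (use C \<eta> in auto)
  then have "(\<lambda>y. min 1 (2 * g y)) \<in> Lipb d"
    by (rule Lipb_compose[OF d, where C = 2]) (simp add: min_def abs_if)
  moreover have "0 \<le> g y" for y unfolding g_def by (rule sum_nonneg) (use C \<eta> in auto)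
  moreover have "g y = 0" if "y \<notin> U" for y
    unfolding g_def by (rule sum.neutral) (use C \<eta> that in auto)
  moreover have "1 \<le> 2 * g y" if y: "y \<in> K" for y
  proof -
    obtain x where x: "x \<in> C" "\<eta> x y > 1/2" using subsetD[OF C(3) y] by auto
    then have "\<eta> x y \<le> g y"
      unfolding g_def by (intro member_le_sum) (use C \<eta> in auto)
    with x show ?thesis by simp
  qed
  ultimately show ?thesis by (intro bexI[of _ "\<lambda>y. min 1 (2 * g y)"]) auto
qed

section \<open>The asymptotic slope\<close>

lemma asymp_slope_nonneg: "0 \<le> asymp_slope d f x"
  by (simp add: asymp_slope_def)

text \<open>\<open>UNIV\<close> is an admissible neighbourhood, so the infimum is finite and
  \<open>enn2real\<close> does not distort the comparison.\<close>

lemma asymp_slope_less_iff: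
  assumes f: "f \<in> Lipb d" and "0 < q"
  shows "asymp_slope d f x < q \<longleftrightarrow> (\<exists>U. open U \<and> x \<in> U \<and> Lip d U f < ennreal q)"
proof -
  have "(INF U\<in>{U. open U \<and> x \<in> U}. Lip d U f) \<le> Lip d UNIV f"
    by (rule INF_lower) auto
  then have "(INF U\<in>{U. open U \<and> x \<in> U}. Lip d U f) < top"
    using f by (auto simp: Lipb_def)
  then obtain r where "0 \<le> r" "(INF U\<in>{U. open U \<and> x \<in> U}. Lip d U f) = ennreal r"
    by (cases "INF U\<in>{U. open U \<and> x \<in> U}. Lip d U f") auto
  then have "asymp_slope d f x < q \<longleftrightarrow> (INF U\<in>{U. open U \<and> x \<in> U}. Lip d U f) < ennreal q"
    by (simp add: asymp_slope_def ennreal_less_iff)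
  then show ?thesis by (simp add: INF_less_iff conj_assoc)
qed

text \<open>Upper semicontinuity of the slope: one neighbourhood that witnesses
  \<open>Lip d U f < q\<close> serves all of its points. It yields Borel measurability and makes the
  sublevel sets measurable.\<close>

lemma open_asymp_slope_less:
  assumes f: "f \<in> Lipb d"
  shows "open {x. asymp_slope d f x < q}"
proof (cases "0 < q")
  case True
  show ?thesis
  proof -
    have "{x. asymp_slope d f x < q} = \<Union>{U. open U \<and> Lip d U f < ennreal q}"
      unfolding asymp_slope_less_iff[OF f True] by blast
    moreover have "open (\<Union>{U. open U \<and> Lip d U f < ennreal q})"
      by (rule open_Union) simp
    ultimately show ?thesis by simp
  qed
next
  case False
  then have "\<not> asymp_slope d f x < q" for x
    using asymp_slope_nonneg[of d f x] by linarith
  then show ?thesis by simp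
qed

lemma asymp_slope_le_Lipb_norm:
  assumes f: "f \<in> Lipb d"
  shows "asymp_slope d f x \<le> Lipb_norm d f"
proof -
  have "asymp_slope d f x \<le> enn2real (Lip d UNIV f)"
    unfolding asymp_slope_def
  proof (rule enn2real_mono)
    show "(INF U\<in>{U. open U \<and> x \<in> U}. Lip d U f) \<le> Lip d UNIV f"
      by (rule INF_lower) simp
  qed (use f in \<open>simp add: Lipb_def\<close>)
  with Lip_le_Lipb_norm[OF f] show ?thesis by linarith
qed

lemma borel_measurable_asymp_slope:
  assumes f: "f \<in> Lipb d"
  shows "asymp_slope d f \<in> borel_measurable borel"
proof (rule borel_measurableI_less)
  show "{x \<in> space borel. asymp_slope d f x < q} \<in> sets borel" for q
    using open_asymp_slope_less[OF f, of q] by simp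
qed

section \<open>Essential infima\<close>

text \<open>Minimise the integral of \<open>arctan (g x)\<close> over \<open>G\<close>. Since
  \<open>arctan\<close> is bounded, no integrability of the members is needed; since it is strictly
  increasing and \<open>G\<close> is closed under minima, a member dipping below the limit of a
  minimising sequence on a set of positive measure would push the integral under its
  infimum.\<close>

lemma is_ess_inf_exists:
  assumes "finite_measure M" "G \<noteq> {}" and meas: "G \<subseteq> borel_measurable M"
    and nonneg: "\<And>g. g \<in> G \<Longrightarrow> AE x in M. 0 \<le> g x"
    and min: "\<And>g h. g \<in> G \<Longrightarrow> h \<in> G \<Longrightarrow> (\<lambda>x. min (g x) (h x)) \<in> G"
  shows "is_ess_inf M G (ess_inf M G)"
proof -
  interpret finite_measure M by fact
  define I where "I g = (\<integral>x. arctan (g x) \<partial>M)" for g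
  have [measurable]: "arctan \<in> borel_measurable borel"
    by (intro borel_measurable_continuous_onI continuous_intros)
  have arctan_le: "\<bar>arctan t\<bar> \<le> 2" for t
    using arctan_bounded[of t] pi_less_4 by auto
  have int: "integrable M (\<lambda>x. arctan (g x))" if [measurable]: "g \<in> borel_measurable M" for g
    by (rule integrable_const_bound[of _ 2]) (use arctan_le in auto)
  have I_nonneg: "0 \<le> I g" if "g \<in> G" for g
    unfolding I_def by (rule integral_nonneg_AE) (use nonneg[OF that] in auto)
  define s where "s = (INF g\<in>G. I g)"
  have bdd: "bdd_below (I ` G)" using I_nonneg by (intro bdd_belowI[of _ 0]) auto
  have "\<exists>g\<in>G. I g < s + 1 / Suc n" for n
    using cINF_less_iff[OF \<open>G \<noteq> {}\<close> bdd, of "s + 1 / Suc n"] by (simp add: s_def)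
  then obtain g where g: "\<And>n. g n \<in> G" "\<And>n. I (g n) < s + 1 / Suc n" by metis
  have g_meas [measurable]: "g n \<in> borel_measurable M" for n using g meas by blast
  \<comment> \<open>The members of \<open>G\<close> are nonnegative only almost everywhere; the
    \<open>max 0\<close> bounds the infimum from below at every point.\<close>
  define h where "h x = (INF n. max 0 (g n x))" for x
  have bdd': "bdd_below (range (\<lambda>n. max 0 (g n x)))" for x
    by (intro bdd_belowI[of _ 0]) auto
  have h_meas [measurable]: "h \<in> borel_measurable M"
    unfolding h_def by (rule borel_measurable_cINF) (auto intro: bdd')
  have h_le: "h x \<le> max 0 (g n x)" for x n
    unfolding h_def by (rule cINF_lower[OF bdd']) auto
  have "AE x in M. h x \<le> f x" if "f \<in> G" for f
  proof -
    have f_meas [measurable]: "f \<in> borel_measurable M" using meas that by blast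
    \<comment> \<open>\<open>p\<close> is the excess of \<open>h\<close> over \<open>f\<close> on
      the \<open>arctan\<close> scale. Replacing \<open>g n\<close> by its minimum with
      \<open>f\<close> lowers the integral by at least that of \<open>p\<close>, yet
      \<open>g n\<close> is within \<open>1 / Suc n\<close> of optimal.\<close>
    define p where "p x = max 0 (arctan (h x) - arctan (f x))" for x
    have p_int: "integrable M p"
      unfolding p_def by (intro integrable_max int Bochner_Integration.integrable_diff) auto
    have "(\<integral>x. p x \<partial>M) \<le> 1 / Suc n" for n
    proof -
      have "(\<integral>x. p x \<partial>M) \<le> (\<integral>x. arctan (g n x) - arctan (min (g n x) (f x)) \<partial>M)"
      proof (rule integral_mono_AE[OF p_int])
        show "AE x in M. p x \<le> arctan (g n x) - arctan (min (g n x) (f x))"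
          using nonneg[OF g(1)[of n]]
        proof eventually_elim
          case (elim x)
          then have "arctan (h x) \<le> arctan (g n x)"
            using h_le[of x n] by (intro arctan_monotone') auto
          moreover have "arctan (min (g n x) (f x)) \<le> arctan (g n x)"
            by (intro arctan_monotone') auto
          moreover have "arctan (min (g n x) (f x)) \<le> arctan (f x)"
            by (intro arctan_monotone') auto
          ultimately show ?case unfolding p_def by auto
        qed
      qed (auto intro!: int Bochner_Integration.integrable_diff)
      also have "\<dots> = I (g n) - I (\<lambda>x. min (g n x) (f x))"
        unfolding I_def by (rule Bochner_Integration.integral_diff) (auto intro!: int)
      also have "\<dots> \<le> 1 / Suc n"
      proof -
        have "s \<le> I (\<lambda>x. min (g n x) (f x))"
          unfolding s_def by (rule cINF_lower[OF bdd]) (use min g(1) that in auto)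
        with g(2)[of n] show ?thesis by linarith
      qed
      finally show ?thesis .
    qed
    then have "(\<integral>x. p x \<partial>M) \<le> 0"
      by (intro LIMSEQ_le_const[OF LIMSEQ_Suc[OF lim_1_over_n]]) auto
    moreover have p_nonneg: "0 \<le> p x" for x by (simp add: p_def)
    ultimately have "(\<integral>x. p x \<partial>M) = 0"
      by (meson Bochner_Integration.integral_nonneg order_antisym)
    then have "AE x in M. p x = 0"
      using integral_nonneg_eq_0_iff_AE[OF p_int] p_nonneg by auto
    then show ?thesis
    proof eventually_elim
      case (elim x)
      then have "arctan (h x) \<le> arctan (f x)" unfolding p_def by linarith
      then show ?case by (simp add: arctan_le_iff)
    qed
  qed
  moreover have "AE x in M. k x \<le> h x" if "\<forall>f\<in>G. AE x in M. k x \<le> f x" for k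
  proof -
    have "AE x in M. \<forall>n. k x \<le> g n x" unfolding AE_all_countable using that g by blast
    then show ?thesis
    proof eventually_elim
      case (elim x)
      show ?case unfolding h_def by (rule cINF_greatest) (use elim in \<open>auto simp: le_max_iff_disj\<close>)
    qed
  qed
  ultimately have "is_ess_inf M G h" unfolding is_ess_inf_def by (auto intro: h_meas)
  then show ?thesis unfolding ess_inf_def by (rule someI[of "is_ess_inf M G"])
qed

text \<open>Where \<open>s\<close> is positive, division turns the inequalities into a lower bound
  \<open>k\<close> of the family, to which the definition applies. Where \<open>s\<close> vanishes,
  any single member already gives \<open>u x \<le> 0\<close>.\<close>

lemma ess_inf_bound:
  assumes h: "is_ess_inf M G h" and "G \<noteq> {}"
    and nonneg: "\<And>g. g \<in> G \<Longrightarrow> AE x in M. 0 \<le> g x"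
    and [measurable]: "u \<in> borel_measurable M" "s \<in> borel_measurable M"
    and s: "\<And>x. 0 \<le> s x"
    and le: "\<And>g. g \<in> G \<Longrightarrow> AE x in M. u x \<le> g x * s x"
  shows "AE x in M. u x \<le> h x * s x"
proof -
  define k where "k x = (if 0 < s x then u x / s x else 0)" for x
  have [measurable]: "k \<in> borel_measurable M" unfolding k_def by measurable
  have "AE x in M. k x \<le> g x" if "g \<in> G" for g
    using le[OF that] nonneg[OF that]
    by eventually_elim (auto simp: k_def pos_divide_le_eq)
  then have kh: "AE x in M. k x \<le> h x" using h by (simp add: is_ess_inf_def)
  obtain g where "g \<in> G" using \<open>G \<noteq> {}\<close> by blast
  from kh le[OF this] show ?thesis
  proof eventually_elim
    case (elim x)
    show ?case
    proof (cases "0 < s x")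
      case True
      then show ?thesis using elim by (simp add: k_def pos_divide_le_eq)
    next
      case False
      with s[of x] have "s x = 0" by linarith
      with elim show ?thesis by simp
    qed
  qed
qed

section \<open>Radon measures\<close>

lemma Radon_inner_compact:
  assumes M: "finite_Radon_measure M" and B: "B \<in> sets M" and "0 < \<epsilon>"
  shows "\<exists>K. compact K \<and> K \<subseteq> B \<and> K \<in> sets M \<and> measure M (B - K) < \<epsilon>"
proof (cases "measure M B < \<epsilon>")
  case True
  then show ?thesis by (intro exI[of _ "{}"]) auto
next
  case False
  interpret finite_measure M using M by (simp add: finite_Radon_measure_def)
  have "ennreal (measure M B - \<epsilon>) < ennreal (measure M B)"
    using \<open>0 < \<epsilon>\<close> False by (subst ennreal_less_iff) auto
  also have "\<dots> = (SUP K\<in>{K. compact K \<and> K \<subseteq> B}. emeasure M K)"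
    using M B by (simp add: finite_Radon_measure_def emeasure_eq_measure)
  finally obtain K where K: "compact K" "K \<subseteq> B" "ennreal (measure M B - \<epsilon>) < emeasure M K"
    by (auto simp: less_SUP_iff)
  have "K \<in> sets M" using K M by (simp add: finite_Radon_measure_def compact_imp_closed)
  moreover have "measure M B - \<epsilon> < measure M K"
    using K(3) False by (simp add: emeasure_eq_measure ennreal_less_iff)
  ultimately show ?thesis using K B finite_measure_Diff[of B K] by auto
qed

text \<open>The null set attached to \<open>V\<close> depends on the point, and a cover of
  \<open>E\<close> by such \<open>V\<close> may be uncountable. Compact sets exhaust
  \<open>E\<close> up to a null set, and each of them needs only finitely many
  \<open>V\<close>.\<close>

lemma Radon_AE_local:
  assumes M: "finite_Radon_measure M" and E: "E \<in> sets M"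
    and loc: "\<And>x. x \<in> E \<Longrightarrow> \<exists>V. open V \<and> x \<in> V \<and> (AE y in M. y \<in> V \<longrightarrow> P y)"
  shows "AE y in M. y \<in> E \<longrightarrow> P y"
proof -
  interpret finite_measure M using M by (simp add: finite_Radon_measure_def)
  have "\<exists>K. compact K \<and> K \<subseteq> E \<and> K \<in> sets M \<and> measure M (E - K) < 1 / Suc n" for n
    by (rule Radon_inner_compact[OF M E]) simp
  then obtain K where K: "\<And>n. compact (K n)" "\<And>n. K n \<subseteq> E" "\<And>n. K n \<in> sets M"
    "\<And>n. measure M (E - K n) < 1 / Suc n" by metis
  obtain V where V: "\<And>x. x \<in> E \<Longrightarrow> open (V x)" "\<And>x. x \<in> E \<Longrightarrow> x \<in> V x"
    "\<And>x. x \<in> E \<Longrightarrow> AE y in M. y \<in> V x \<longrightarrow> P y" using loc by metis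
  have "AE y in M. y \<in> K n \<longrightarrow> P y" for n
  proof -
    have "\<forall>x\<in>K n. open (V x)" "K n \<subseteq> (\<Union>x\<in>K n. V x)" using K(2)[of n] V by blast+
    then obtain C where C: "C \<subseteq> K n" "finite C" "K n \<subseteq> (\<Union>x\<in>C. V x)"
      using compactE_image[OF K(1)[of n], of "K n" V] by metis
    have "AE y in M. \<forall>x\<in>C. y \<in> V x \<longrightarrow> P y"
      by (rule AE_finite_allI[OF C(2)]) (use C K(2) V in blast)
    then show ?thesis by eventually_elim (use C(3) in blast)
  qed
  then have 1: "AE y in M. \<forall>n. y \<in> K n \<longrightarrow> P y"
    unfolding AE_all_countable by blast
  have "measure M (E - (\<Union>n. K n)) \<le> 1 / Suc n" for n
  proof -
    have "measure M (E - (\<Union>n. K n)) \<le> measure M (E - K n)"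
      by (rule finite_measure_mono) (use E K(3) in auto)
    with K(4)[of n] show ?thesis by linarith
  qed
  then have "measure M (E - (\<Union>n. K n)) \<le> 0"
    by (intro LIMSEQ_le_const[OF LIMSEQ_Suc[OF lim_1_over_n]]) auto
  then have "emeasure M (E - (\<Union>n. K n)) = 0"
    by (simp add: emeasure_eq_measure order_antisym)
  moreover have "E - (\<Union>n. K n) \<in> sets M" using E K(3) by auto
  ultimately have "AE y in M. y \<notin> E - (\<Union>n. K n)" by (intro AE_not_in) auto
  with 1 show ?thesis by eventually_elim blast
qed

section \<open>Density of \<open>Lipb d\<close> in \<open>L^1\<close> and weak-star
  convergence\<close>

lemma borel_measurable_Lipb:
  assumes "finite_Radon_measure M" "f \<in> Lipb d"
  shows "f \<in> borel_measurable M"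
proof -
  have "f \<in> borel_measurable borel"
    using assms(2) by (intro borel_measurable_continuous_onI) (simp add: Lipb_def)
  then show ?thesis
    using assms(1) measurable_cong_sets[of M borel borel borel]
    by (auto simp: finite_Radon_measure_def)
qed

text \<open>Inner regularity is applied to \<open>A\<close> and to its complement. The compact
  \<open>H\<close> in the complement is closed by Hausdorffness, so \<open>- H\<close> is an open
  neighbourhood of \<open>K\<close>; a Urysohn function for this pair can differ from the indicator
  only on \<open>A - K\<close> and \<open>- A - H\<close>.\<close>

lemma Lipb_dense_indicator:
  fixes d :: "'a::t2_space \<Rightarrow> 'a \<Rightarrow> ennreal"
  assumes S: "ext_metric_top_measure_space d M" and A: "A \<in> sets M" and "0 < \<epsilon>"
  shows "\<exists>f\<in>Lipb d. (\<forall>x. \<bar>f x\<bar> \<le> 1) \<and> (\<integral>x. \<bar>indicat_real A x - f x\<bar> \<partial>M) < \<epsilon>"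
proof -
  have M: "finite_Radon_measure M" and T: "ext_metric_top_space d"
    using S by (auto simp: ext_metric_top_measure_space_def)
  interpret finite_measure M using M by (simp add: finite_Radon_measure_def)
  have sp: "space M = UNIV" using M sets_eq_imp_space_eq by (fastforce simp: finite_Radon_measure_def)
  have A': "- A \<in> sets M" using sets.compl_sets[OF A] by (simp add: sp Compl_eq_Diff_UNIV)
  obtain K where K: "compact K" "K \<subseteq> A" "K \<in> sets M" "measure M (A - K) < \<epsilon> / 2"
    using Radon_inner_compact[OF M A, of "\<epsilon> / 2"] \<open>0 < \<epsilon>\<close> by auto
  obtain H where H: "compact H" "H \<subseteq> - A" "H \<in> sets M" "measure M (- A - H) < \<epsilon> / 2"
    using Radon_inner_compact[OF M A', of "\<epsilon> / 2"] \<open>0 < \<epsilon>\<close> by auto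
  have "open (- H)" "K \<subseteq> - H" using H K compact_imp_closed by auto
  then obtain f where f: "f \<in> Lipb d" "\<forall>x\<in>K. f x = 1" "\<forall>y. 0 \<le> f y \<and> f y \<le> 1"
    "\<forall>y. y \<notin> - H \<longrightarrow> f y = 0"
    using Lipb_Urysohn[OF T _ K(1)] by metis
  have [measurable]: "f \<in> borel_measurable M" by (rule borel_measurable_Lipb[OF M f(1)])
  note [measurable] = A A' K(3) H(3)
  have ind: "integrable M (indicat_real B)" if "B \<in> sets M" for B
    using that by (intro integrable_real_indicator) (auto simp: less_top[symmetric])
  have "(\<integral>x. \<bar>indicat_real A x - f x\<bar> \<partial>M)
      \<le> (\<integral>x. indicat_real (A - K) x + indicat_real (- A - H) x \<partial>M)"
  proof (rule integral_mono_AE)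
    show "integrable M (\<lambda>x. \<bar>indicat_real A x - f x\<bar>)"
    proof (rule integrable_const_bound[of _ 1])
      have "norm \<bar>indicat_real A x - f x\<bar> \<le> 1" for x
        using f(3)[rule_format, of x] by (auto simp: indicator_def abs_le_iff)
      then show "AE x in M. norm \<bar>indicat_real A x - f x\<bar> \<le> 1" by simp
    qed measurable
    show "AE x in M. \<bar>indicat_real A x - f x\<bar> \<le> indicat_real (A - K) x + indicat_real (- A - H) x"
    proof (rule AE_I2)
      fix x
      show "\<bar>indicat_real A x - f x\<bar> \<le> indicat_real (A - K) x + indicat_real (- A - H) x"
        using f(3)[rule_format, of x] f(2,4) K(2) H(2) by (auto simp: indicator_def abs_le_iff)
    qed
  qed (auto intro!: ind)
  also have "\<dots> = measure M (A - K) + measure M (- A - H)"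
    by (subst Bochner_Integration.integral_add) (auto intro!: ind)
  also have "\<dots> < \<epsilon>" using K(4) H(4) by linarith
  finally show ?thesis using f by (intro bexI[of _ f]) auto
qed

text \<open>The common bound \<open>C\<close> makes all the pairings Lipschitz in the
  \<open>L^1\<close> norm of the test function, uniformly in \<open>n\<close>. The test functions
  with convergent pairings are thus closed in \<open>L^1\<close>, and they contain a dense
  set.\<close>

lemma weak_star_tendsto_Lipb:
  fixes d :: "'a::t2_space \<Rightarrow> 'a \<Rightarrow> ennreal"
  assumes S: "ext_metric_top_measure_space d M"
    and hm: "\<And>n. h n \<in> borel_measurable M" and h0m: "h0 \<in> borel_measurable M"
    and hC: "\<And>n. AE x in M. \<bar>h n x\<bar> \<le> C" and h0C: "AE x in M. \<bar>h0 x\<bar> \<le> C" and "0 \<le> C"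
    and lim: "\<And>\<phi>. \<phi> \<in> Lipb d \<Longrightarrow>
      (\<lambda>n. \<integral>x. h n x * \<phi> x \<partial>M) \<longlonglongrightarrow> (\<integral>x. h0 x * \<phi> x \<partial>M)"
  shows "weak_star_tendsto M h h0"
proof -
  have M: "finite_Radon_measure M" using S by (simp add: ext_metric_top_measure_space_def)
  interpret finite_measure M using M by (simp add: finite_Radon_measure_def)
  note [measurable] = hm h0m
  define good where "good \<phi> \<longleftrightarrow>
    (\<lambda>n. \<integral>x. h n x * \<phi> x \<partial>M) \<longlonglongrightarrow> (\<integral>x. h0 x * \<phi> x \<partial>M)" for \<phi>
  have int: "integrable M (\<lambda>x. u x * \<phi> x)"
    if [measurable]: "u \<in> borel_measurable M" and u: "AE x in M. \<bar>u x\<bar> \<le> C" and \<phi>: "integrable M \<phi>"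
    for u \<phi>
  proof (rule Bochner_Integration.integrable_bound[of M "\<lambda>x. C * \<bar>\<phi> x\<bar>"])
    show "AE x in M. norm (u x * \<phi> x) \<le> norm (C * \<bar>\<phi> x\<bar>)"
      using u by eventually_elim (use \<open>0 \<le> C\<close> in \<open>auto simp: abs_mult intro: mult_right_mono\<close>)
  qed (use \<phi> in auto)
  have bd: "\<bar>(\<integral>x. u x * \<phi> x \<partial>M) - (\<integral>x. u x * \<psi> x \<partial>M)\<bar> \<le> C * (\<integral>x. \<bar>\<phi> x - \<psi> x\<bar> \<partial>M)"
    if u: "u \<in> borel_measurable M" "AE x in M. \<bar>u x\<bar> \<le> C" and \<phi>: "integrable M \<phi>" "integrable M \<psi>"
    for u \<phi> \<psi>
  proof -
    have "(\<integral>x. u x * \<phi> x \<partial>M) - (\<integral>x. u x * \<psi> x \<partial>M) = (\<integral>x. u x * (\<phi> x - \<psi> x) \<partial>M)"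
      unfolding right_diff_distrib
      by (rule Bochner_Integration.integral_diff[symmetric]) (auto intro!: int u \<phi>)
    also have "\<bar>\<dots>\<bar> \<le> (\<integral>x. \<bar>u x * (\<phi> x - \<psi> x)\<bar> \<partial>M)" by (rule integral_abs_bound)
    also have "\<dots> \<le> (\<integral>x. C * \<bar>\<phi> x - \<psi> x\<bar> \<partial>M)"
    proof (rule integral_mono_AE)
      show "AE x in M. \<bar>u x * (\<phi> x - \<psi> x)\<bar> \<le> C * \<bar>\<phi> x - \<psi> x\<bar>"
        using u(2) by eventually_elim (auto simp: abs_mult intro: mult_right_mono)
    qed (auto intro!: int u \<phi> integrable_abs Bochner_Integration.integrable_diff)
    finally show ?thesis by simp
  qed
  have approx: "good \<phi>" if \<phi>: "integrable M \<phi>"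
    and app: "\<And>\<epsilon>. 0 < \<epsilon> \<Longrightarrow> \<exists>\<psi>. integrable M \<psi> \<and> good \<psi> \<and> (\<integral>x. \<bar>\<phi> x - \<psi> x\<bar> \<partial>M) < \<epsilon>" for \<phi>
    unfolding good_def
  proof (rule LIMSEQ_I)
    fix e :: real assume "0 < e"
    \<comment> \<open>One third of \<open>e\<close> for exchanging \<open>\<phi>\<close> and
      \<open>\<psi>\<close> against \<open>h n\<close>, one for the same against \<open>h0\<close>,
      one for convergence on \<open>\<psi>\<close>. The \<open>+ 1\<close> covers
      \<open>C = 0\<close>.\<close>
    define \<epsilon> where "\<epsilon> = e / (3 * (C + 1))"
    have "0 < \<epsilon>" using \<open>0 < e\<close> \<open>0 \<le> C\<close> by (simp add: \<epsilon>_def)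
    then obtain \<psi> where \<psi>: "integrable M \<psi>" "good \<psi>" "(\<integral>x. \<bar>\<phi> x - \<psi> x\<bar> \<partial>M) < \<epsilon>"
      using app by blast
    have "C * (\<integral>x. \<bar>\<phi> x - \<psi> x\<bar> \<partial>M) \<le> C * \<epsilon>"
      using \<psi>(3) \<open>0 \<le> C\<close> by (intro mult_left_mono) auto
    also have "\<dots> \<le> e / 3"
      using \<open>0 < e\<close> \<open>0 \<le> C\<close> by (simp add: \<epsilon>_def field_simps)
    finally have le: "C * (\<integral>x. \<bar>\<phi> x - \<psi> x\<bar> \<partial>M) \<le> e / 3" .
    obtain n0 where n0: "\<And>n. n \<ge> n0 \<Longrightarrow>
        \<bar>(\<integral>x. h n x * \<psi> x \<partial>M) - (\<integral>x. h0 x * \<psi> x \<partial>M)\<bar> < e / 3"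
      using LIMSEQ_D[OF \<psi>(2)[unfolded good_def], of "e / 3"] \<open>0 < e\<close> by auto
    show "\<exists>no. \<forall>n\<ge>no. norm ((\<integral>x. h n x * \<phi> x \<partial>M) - (\<integral>x. h0 x * \<phi> x \<partial>M)) < e"
    proof (intro exI[of _ n0] allI impI)
      fix n assume "n0 \<le> n"
      show "norm ((\<integral>x. h n x * \<phi> x \<partial>M) - (\<integral>x. h0 x * \<phi> x \<partial>M)) < e"
        using n0[OF \<open>n0 \<le> n\<close>] bd[OF hm hC \<phi> \<psi>(1), of n] bd[OF h0m h0C \<phi> \<psi>(1)] le
        unfolding real_norm_def by linarith
    qed
  qed
  have Lipb_int: "integrable M f" if f: "f \<in> Lipb d" for f
    by (rule integrable_const_bound[of _ "Lipb_norm d f"])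
      (use abs_le_Lipb_norm[OF f] borel_measurable_Lipb[OF M f] in auto)
  have "good \<phi>" if "integrable M \<phi>" for \<phi> using that
  proof (induction rule: integrable_induct)
    case (base A c)
    have "good (indicat_real A)"
    proof (rule approx)
      show "integrable M (indicat_real A)"
        using base by (intro integrable_real_indicator) (auto simp: less_top[symmetric])
      show "\<exists>\<psi>. integrable M \<psi> \<and> good \<psi> \<and> (\<integral>x. \<bar>indicat_real A x - \<psi> x\<bar> \<partial>M) < \<epsilon>"
        if "0 < \<epsilon>" for \<epsilon>
        using Lipb_dense_indicator[OF S base(1) that] Lipb_int lim unfolding good_def by blast
    qed
    then have "(\<lambda>n. (\<integral>x. h n x * indicat_real A x \<partial>M) * c) \<longlonglongrightarrow> (\<integral>x. h0 x * indicat_real A x \<partial>M) * c"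
      unfolding good_def by (intro tendsto_mult tendsto_const)
    then show ?case by (simp add: good_def mult.assoc flip: integral_mult_left_zero)
  next
    case (add f g)
    have "(\<integral>x. u x * (f x + g x) \<partial>M) = (\<integral>x. u x * f x \<partial>M) + (\<integral>x. u x * g x \<partial>M)"
      if u: "u \<in> borel_measurable M" "AE x in M. \<bar>u x\<bar> \<le> C" for u
      unfolding distrib_left
      by (rule Bochner_Integration.integral_add) (auto intro!: int u add)
    then show ?case
      using add hm h0m hC h0C unfolding good_def by (auto intro!: tendsto_add)
  next
    case (lim f s)
    have "(\<lambda>i. \<integral>x. \<bar>f x - s i x\<bar> \<partial>M) \<longlonglongrightarrow> (\<integral>x. 0 \<partial>M)"
    proof (rule integral_dominated_convergence[where w = "\<lambda>x. 3 * \<bar>f x\<bar>"])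
      show "AE x in M. (\<lambda>i. \<bar>f x - s i x\<bar>) \<longlonglongrightarrow> 0"
      proof (rule AE_I2)
        fix x assume "x \<in> space M"
        then have "(\<lambda>i. \<bar>f x - s i x\<bar>) \<longlonglongrightarrow> \<bar>f x - f x\<bar>"
          by (intro tendsto_intros lim)
        then show "(\<lambda>i. \<bar>f x - s i x\<bar>) \<longlonglongrightarrow> 0" by simp
      qed
      show "AE x in M. norm \<bar>f x - s i x\<bar> \<le> 3 * \<bar>f x\<bar>" for i
      proof (rule AE_I2)
        fix x assume "x \<in> space M"
        then have "\<bar>s i x\<bar> \<le> 2 * \<bar>f x\<bar>" using lim(3)[of x i] by simp
        then show "norm \<bar>f x - s i x\<bar> \<le> 3 * \<bar>f x\<bar>" by simp
      qed
    qed (use lim in auto)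
    then have L: "(\<lambda>i. \<integral>x. \<bar>f x - s i x\<bar> \<partial>M) \<longlonglongrightarrow> 0" by simp
    show ?case
    proof (rule approx[OF lim(4)])
      fix \<epsilon> :: real assume "0 < \<epsilon>"
      then have "eventually (\<lambda>i. (\<integral>x. \<bar>f x - s i x\<bar> \<partial>M) < \<epsilon>) sequentially"
        using L by (simp add: order_tendstoD)
      then obtain i where "(\<integral>x. \<bar>f x - s i x\<bar> \<partial>M) < \<epsilon>"
        by (auto simp: eventually_sequentially)
      then show "\<exists>\<psi>. integrable M \<psi> \<and> good \<psi> \<and> (\<integral>x. \<bar>f x - \<psi> x\<bar> \<partial>M) < \<epsilon>"
        using lim by blast
    qed
  qed
  then show ?thesis unfolding weak_star_tendsto_def good_def by blast
qed

section \<open>Uniform boundedness of weakly* convergent sequences\<close>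

lemma AE_summable_of_integral:
  fixes f :: "nat \<Rightarrow> 'a \<Rightarrow> real"
  assumes int: "\<And>i. integrable M (f i)" and sum: "summable (\<lambda>i. \<integral>x. \<bar>f i x\<bar> \<partial>M)"
  shows "AE x in M. summable (\<lambda>i. \<bar>f i x\<bar>)"
proof -
  have meas: "(\<lambda>x. ennreal \<bar>f i x\<bar>) \<in> borel_measurable M" for i
    using borel_measurable_integrable[OF int[of i]] by measurable
  have "(\<integral>\<^sup>+x. (\<Sum>i. ennreal \<bar>f i x\<bar>) \<partial>M) = (\<Sum>i. \<integral>\<^sup>+x. ennreal \<bar>f i x\<bar> \<partial>M)"
    by (rule nn_integral_suminf[OF meas])
  also have "\<dots> = (\<Sum>i. ennreal (\<integral>x. \<bar>f i x\<bar> \<partial>M))"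
    using nn_integral_eq_integral[OF integrable_abs[OF int]] by simp
  also have "\<dots> = ennreal (\<Sum>i. \<integral>x. \<bar>f i x\<bar> \<partial>M)"
    by (rule suminf_ennreal2[OF _ sum]) simp
  finally have "(\<integral>\<^sup>+x. (\<Sum>i. ennreal \<bar>f i x\<bar>) \<partial>M) \<noteq> \<infinity>" by simp
  then have "AE x in M. (\<Sum>i. ennreal \<bar>f i x\<bar>) \<noteq> \<infinity>"
    by (rule nn_integral_PInf_AE[rotated]) (rule borel_measurable_suminf_order[OF meas])
  then show ?thesis
  proof eventually_elim
    case (elim x)
    then show ?case by (intro summable_suminf_not_top) simp_all
  qed
qed

text \<open>\<open>N\<close> lies within the factor 4/3 of the essential supremum \<open>s\<close>
  of |h|, so |h| exceeds \<open>3 / 4 * N\<close> on a set \<open>A\<close> of positive measure. The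
  normalised sign of \<open>h\<close> on \<open>A\<close> is the required
  \<open>\<psi>\<close>.\<close>

lemma Linf_near_norming:
  assumes M: "finite_measure M" and h: "h \<in> Linf M" and "0 < c"
    and not: "\<not> (AE x in M. \<bar>h x\<bar> \<le> c)"
  obtains N \<psi> where "c \<le> N" "AE x in M. \<bar>h x\<bar> \<le> N" "integrable M \<psi>"
    "(\<integral>x. \<bar>\<psi> x\<bar> \<partial>M) = 1" "3 / 4 * N \<le> (\<integral>x. h x * \<psi> x \<partial>M)"
proof -
  interpret finite_measure M by fact
  have [measurable]: "h \<in> borel_measurable M" using h by (simp add: Linf_def)
  define S where "S = {t. AE x in M. \<bar>h x\<bar> \<le> t}"
  have S_ge: "c \<le> t" if "t \<in> S" for t
  proof (rule ccontr)
    assume "\<not> c \<le> t"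
    from that have "AE x in M. \<bar>h x\<bar> \<le> t" by (simp add: S_def)
    then have "AE x in M. \<bar>h x\<bar> \<le> c" by eventually_elim (use \<open>\<not> c \<le> t\<close> in linarith)
    with not show False ..
  qed
  have "S \<noteq> {}" using h by (auto simp: S_def Linf_def)
  have bdd: "bdd_below S" by (rule bdd_belowI[of _ c]) (rule S_ge)
  define s where "s = Inf S"
  have "c \<le> s" unfolding s_def by (rule cInf_greatest[OF \<open>S \<noteq> {}\<close>]) (rule S_ge)
  then have "s < 4 / 3 * s" using \<open>0 < c\<close> by simp
  then obtain N where N: "N \<in> S" "N < 4 / 3 * s"
    using cInf_lessD[OF \<open>S \<noteq> {}\<close>, of "4 / 3 * s"] by (auto simp: s_def)
  have "3 / 4 * N \<notin> S"
  proof
    assume "3 / 4 * N \<in> S"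
    then have "s \<le> 3 / 4 * N" unfolding s_def by (rule cInf_lower[OF _ bdd])
    with N(2) show False by simp
  qed
  have "c \<le> N" using S_ge N(1) .
  define A where "A = {x \<in> space M. 3 / 4 * N < \<bar>h x\<bar>}"
  have [measurable]: "A \<in> sets M" unfolding A_def by measurable
  have "measure M A \<noteq> 0"
  proof
    assume "measure M A = 0"
    then have "AE x in M. x \<notin> A" by (intro AE_not_in) (simp add: null_sets_def emeasure_eq_measure)
    then have "AE x in M. \<bar>h x\<bar> \<le> 3 / 4 * N"
      using AE_space by eventually_elim (auto simp: A_def)
    with \<open>3 / 4 * N \<notin> S\<close> show False by (simp add: S_def)
  qed
  then have m: "0 < measure M A" by (simp add: zero_less_measure_iff)
  have ind: "integrable M (\<lambda>x. r * indicat_real A x)" for r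
    by (intro integrable_mult_right integrable_real_indicator) (auto simp: less_top[symmetric])
  have ind_eq: "(\<integral>x. r * indicat_real A x \<partial>M) = r * measure M A" for r
    by simp
  define \<psi> where "\<psi> x = sgn (h x) * (1 / measure M A * indicat_real A x)" for x
  have abs_\<psi>: "\<bar>\<psi> x\<bar> = 1 / measure M A * indicat_real A x" for x
    using \<open>c \<le> N\<close> \<open>0 < c\<close> m by (auto simp: \<psi>_def A_def indicator_def abs_mult abs_sgn_eq)
  have h\<psi>: "h x * \<psi> x = \<bar>h x\<bar> * (1 / measure M A * indicat_real A x)" for x
    unfolding \<psi>_def by (simp add: abs_sgn mult.assoc)
  show ?thesis
  proof (rule that)
    show "c \<le> N" by fact
    show hN: "AE x in M. \<bar>h x\<bar> \<le> N" using N(1) by (simp add: S_def)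
    show int: "integrable M \<psi>"
    proof (rule Bochner_Integration.integrable_bound[OF ind[of "1 / measure M A"]])
      show "\<psi> \<in> borel_measurable M" unfolding \<psi>_def by measurable
      show "AE x in M. norm (\<psi> x) \<le> norm (1 / measure M A * indicat_real A x)"
        using abs_\<psi> by simp
    qed
    show "(\<integral>x. \<bar>\<psi> x\<bar> \<partial>M) = 1" unfolding abs_\<psi> ind_eq using m by simp
    have "3 / 4 * N = (\<integral>x. 3 / 4 * N / measure M A * indicat_real A x \<partial>M)"
      unfolding ind_eq using m by simp
    also have "\<dots> \<le> (\<integral>x. h x * \<psi> x \<partial>M)"
    proof (rule integral_mono_AE[OF ind])
      show "integrable M (\<lambda>x. h x * \<psi> x)"
      proof (rule Bochner_Integration.integrable_bound[OF ind[of "N / measure M A"]])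
        show "(\<lambda>x. h x * \<psi> x) \<in> borel_measurable M" using int by measurable
        show "AE x in M. norm (h x * \<psi> x) \<le> norm (N / measure M A * indicat_real A x)"
          using hN
        proof eventually_elim
          case (elim x)
          show ?case unfolding real_norm_def abs_mult abs_\<psi> using elim m
            by (auto simp: indicator_def abs_mult divide_right_mono)
        qed
      qed
      show "AE x in M. 3 / 4 * N / measure M A * indicat_real A x \<le> h x * \<psi> x"
      proof (rule AE_I2)
        fix x
        show "3 / 4 * N / measure M A * indicat_real A x \<le> h x * \<psi> x"
        proof (cases "x \<in> A")
          case True
          then have "3 / 4 * N \<le> \<bar>h x\<bar>" by (simp add: A_def)
          then have "3 / 4 * N / measure M A \<le> \<bar>h x\<bar> / measure M A"
            by (rule divide_right_mono) simp
          with True show ?thesis unfolding h\<psi> by simp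
        next
          case False
          then show ?thesis unfolding h\<psi> by simp
        qed
      qed
    qed
    finally show "3 / 4 * N \<le> (\<integral>x. h x * \<psi> x \<partial>M)" .
  qed
qed

text \<open>The test function is the sum of near-norming functions with weights \<open>\<plusminus> 3\<^sup>-\<^sup>k\<close>. The sign of the
  \<open>k\<close>-th term is chosen so that it does not cancel the pairing of \<open>h k\<close> with the preceding terms, and
  the remaining terms are too small to do so.\<close>

lemma unbounded_pairing:
  assumes M: "finite_measure M" and h: "\<And>n. h n \<in> Linf M"
    and not: "\<And>n. \<not> (AE x in M. \<bar>h n x\<bar> \<le> 4 ^ n)"
  shows "\<exists>\<phi>. integrable M \<phi> \<and> \<not> Bseq (\<lambda>n. \<integral>x. h n x * \<phi> x \<partial>M)"
proof -
  interpret finite_measure M by fact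
  have [measurable]: "h n \<in> borel_measurable M" for n using h[of n] by (simp add: Linf_def)
  define Q where "Q n N \<psi> \<longleftrightarrow> 4 ^ n \<le> N \<and> (AE x in M. \<bar>h n x\<bar> \<le> N) \<and> integrable M \<psi> \<and>
    (\<integral>x. \<bar>\<psi> x\<bar> \<partial>M) = 1 \<and> 3 / 4 * N \<le> (\<integral>x. h n x * \<psi> x \<partial>M)" for n N \<psi>
  have "\<exists>N \<psi>. Q n N \<psi>" for n
  proof -
    have "(0::real) < 4 ^ n" by simp
    then show ?thesis
      by (rule Linf_near_norming[OF M h _ not]) (unfold Q_def, blast)
  qed
  then obtain N \<psi> where Q: "\<And>n. Q n (N n) (\<psi> n)" by metis
  have N: "4 ^ n \<le> N n" and hN: "AE x in M. \<bar>h n x\<bar> \<le> N n"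
    and \<psi>: "integrable M (\<psi> n)" "(\<integral>x. \<bar>\<psi> n x\<bar> \<partial>M) = 1"
    and pair: "3 / 4 * N n \<le> (\<integral>x. h n x * \<psi> n x \<partial>M)" for n
    using Q[of n] unfolding Q_def by blast+
  note [measurable] = borel_measurable_integrable[OF \<psi>(1)]
  define a where "a i j = (\<integral>x. h i x * \<psi> j x \<partial>M)" for i j
  have N_nonneg: "0 \<le> N i" for i using N[of i] zero_le_power[of "4::real" i] by linarith
  have h_int: "integrable M (\<lambda>x. h i x * \<psi> j x)" for i j
  proof (rule Bochner_Integration.integrable_bound[of M "\<lambda>x. N i * \<bar>\<psi> j x\<bar>"])
    show "AE x in M. norm (h i x * \<psi> j x) \<le> norm (N i * \<bar>\<psi> j x\<bar>)"
      using hN[of i] by eventually_elim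
        (use N_nonneg in \<open>auto simp: abs_mult intro: mult_right_mono\<close>)
  qed (use \<psi> in auto)
  have a_abs: "(\<integral>x. \<bar>h i x * \<psi> j x\<bar> \<partial>M) \<le> N i" for i j
  proof -
    have "(\<integral>x. \<bar>h i x * \<psi> j x\<bar> \<partial>M) \<le> (\<integral>x. N i * \<bar>\<psi> j x\<bar> \<partial>M)"
    proof (rule integral_mono_AE)
      show "AE x in M. \<bar>h i x * \<psi> j x\<bar> \<le> N i * \<bar>\<psi> j x\<bar>"
        using hN[of i] by eventually_elim (auto simp: abs_mult intro: mult_right_mono)
    qed (use h_int \<psi> in auto)
    then show ?thesis by (simp add: \<psi>)
  qed
  \<comment> \<open>\<open>P k i\<close> is the pairing of \<open>h i\<close> with the first
    \<open>k\<close> terms. The recursion carries every \<open>i\<close> at once because the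
    \<open>k\<close>-th sign is read off from \<open>P k k\<close>.\<close>
  define P where "P = rec_nat (\<lambda>_. 0)
    (\<lambda>k p i. p i + (if 0 \<le> p k then 1 else - 1) * (1 / 3) ^ k * a i k)"
  define \<sigma> :: "nat \<Rightarrow> real" where "\<sigma> k = (if 0 \<le> P k k then 1 else - 1)" for k
  have \<sigma>_abs: "\<bar>\<sigma> k\<bar> = 1" for k by (simp add: \<sigma>_def)
  have P_Suc: "P (Suc k) i = P k i + \<sigma> k * (1 / 3) ^ k * a i k" for k i
    by (simp add: P_def \<sigma>_def)
  have P_sum: "P k i = (\<Sum>j<k. \<sigma> j * (1 / 3) ^ j * a i j)" for k i
    by (induction k) (simp_all add: P_Suc, simp add: P_def)
  define F where "F j x = \<sigma> j * (1 / 3) ^ j * \<psi> j x" for j x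
  have F_int: "integrable M (F j)" for j unfolding F_def using \<psi> by auto
  have geo: "summable (\<lambda>j. (1 / 3 :: real) ^ j)" by (rule summable_geometric) simp
  have F_abs: "(\<integral>x. \<bar>F j x\<bar> \<partial>M) = (1 / 3) ^ j" for j
    unfolding F_def abs_mult by (simp add: \<sigma>_abs \<psi> power_abs)
  have F_summable: "AE x in M. summable (\<lambda>j. \<bar>F j x\<bar>)"
    by (rule AE_summable_of_integral[OF F_int]) (use geo in \<open>simp add: F_abs\<close>)
  define \<phi> where "\<phi> x = (\<Sum>j. F j x)" for x
  have \<phi>_int: "integrable M \<phi>"
    unfolding \<phi>_def by (rule integrable_suminf[OF F_int]) (use F_summable geo in \<open>auto simp: F_abs\<close>)
  have sums: "(\<lambda>j. \<sigma> j * (1 / 3) ^ j * a i j) sums (\<integral>x. h i x * \<phi> x \<partial>M)" for i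
  proof -
    have hF: "h i x * F j x = \<sigma> j * (1 / 3) ^ j * (h i x * \<psi> j x)" for x j
      by (simp add: F_def)
    have hF_int: "integrable M (\<lambda>x. h i x * F j x)" for j
      unfolding hF by (intro integrable_mult_right h_int)
    have hF_summable: "summable (\<lambda>j. \<integral>x. \<bar>h i x * F j x\<bar> \<partial>M)"
    proof (rule summable_comparison_test'[OF summable_mult[OF geo, of "N i"], of 0])
      show "norm (\<integral>x. \<bar>h i x * F j x\<bar> \<partial>M) \<le> N i * (1 / 3) ^ j" for j
      proof -
        have "(\<integral>x. \<bar>h i x * F j x\<bar> \<partial>M) = (1 / 3) ^ j * (\<integral>x. \<bar>h i x * \<psi> j x\<bar> \<partial>M)"
          unfolding hF by (subst abs_mult) (simp add: abs_mult \<sigma>_abs power_abs)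
        then show ?thesis using mult_left_mono[OF a_abs, of "(1 / 3) ^ j"] by (simp add: mult.commute)
      qed
    qed
    have "(\<lambda>j. \<integral>x. h i x * F j x \<partial>M) sums (\<integral>x. (\<Sum>j. h i x * F j x) \<partial>M)"
    proof (rule sums_integral[OF hF_int])
      show "AE x in M. summable (\<lambda>j. norm (h i x * F j x))"
        using AE_summable_of_integral[OF hF_int hF_summable] by simp
    qed (use hF_summable in simp)
    moreover have "(\<integral>x. (\<Sum>j. h i x * F j x) \<partial>M) = (\<integral>x. h i x * \<phi> x \<partial>M)"
    proof (rule integral_cong_AE)
      show "AE x in M. (\<Sum>j. h i x * F j x) = h i x * \<phi> x"
        using F_summable
        by eventually_elim (simp add: \<phi>_def suminf_mult summable_rabs_cancel)
      show "(\<lambda>x. h i x * \<phi> x) \<in> borel_measurable M"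
        using borel_measurable_integrable[OF \<phi>_int] by measurable
      show "(\<lambda>x. \<Sum>j. h i x * F j x) \<in> borel_measurable M"
        using hF_int by (intro borel_measurable_suminf) auto
    qed
    moreover have "(\<integral>x. h i x * F j x \<partial>M) = \<sigma> j * (1 / 3) ^ j * a i j" for j
      unfolding hF a_def by simp
    ultimately show ?thesis by simp
  qed
  \<comment> \<open>In units of \<open>N i * (1 / 3) ^ i\<close>: the terms up to \<open>i\<close>
    contribute at least 3/4, since the sign adds the \<open>i\<close>-th term to the partial sum
    without cancellation; the later terms contribute at most 1/3 + 1/9 + ... = 1/2. The remaining
    1/4 still grows, as \<open>N i\<close> is at least \<open>4 ^ i\<close>.\<close>
  have large: "(4 / 3) ^ i / 4 \<le> \<bar>\<integral>x. h i x * \<phi> x \<partial>M\<bar>" for i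
  proof -
    define t where "t j = \<sigma> j * (1 / 3) ^ j * a i j" for j
    have ia: "\<bar>a i j\<bar> \<le> N i" for j
      using a_abs[of i j] integral_abs_bound[of M "\<lambda>x. h i x * \<psi> j x"] unfolding a_def by linarith
    have t_le: "\<bar>t j\<bar> \<le> N i * (1 / 3) ^ j" for j
      using mult_right_mono[OF ia, of "(1 / 3) ^ j"]
      by (simp add: t_def abs_mult \<sigma>_abs power_abs mult.commute)
    have tail_le: "norm (t (j + Suc i)) \<le> N i * (1 / 3) ^ Suc i * (1 / 3) ^ j" for j
      using t_le[of "j + Suc i"] by (simp add: power_add mult_ac)
    have "norm (\<Sum>j. t (j + Suc i)) \<le> (\<Sum>j. N i * (1 / 3) ^ Suc i * (1 / 3) ^ j)"
      by (rule norm_suminf_le[OF tail_le summable_mult[OF geo]])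
    also have "\<dots> = N i * (1 / 3) ^ Suc i * (3 / 2)"
      by (subst suminf_mult[OF geo]) (simp add: suminf_geometric)
    finally have tail: "\<bar>\<Sum>j. t (j + Suc i)\<bar> \<le> N i * (1 / 3) ^ i / 2" by simp
    have "3 / 4 * N i * (1 / 3) ^ i \<le> (1 / 3) ^ i * a i i"
      using mult_right_mono[OF pair[of i], of "(1 / 3) ^ i"] by (simp add: a_def mult.commute)
    moreover have "0 \<le> 3 / 4 * N i * (1 / 3) ^ i" using N_nonneg by simp
    moreover have "r \<le> \<bar>p + (if 0 \<le> p then 1 else - 1) * u\<bar>" if "r \<le> u" "0 \<le> r" for r u p :: real
      using that by auto
    ultimately have "3 / 4 * N i * (1 / 3) ^ i \<le> \<bar>P (Suc i) i\<bar>"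
      unfolding P_Suc \<sigma>_def mult.assoc by blast
    then have head: "3 / 4 * N i * (1 / 3) ^ i \<le> \<bar>\<Sum>j<Suc i. t j\<bar>"
      by (simp only: P_sum t_def)
    have "t sums (\<integral>x. h i x * \<phi> x \<partial>M)" using sums unfolding t_def .
    then have eq: "(\<integral>x. h i x * \<phi> x \<partial>M) = (\<Sum>j. t (j + Suc i)) + (\<Sum>j<Suc i. t j)"
      using suminf_split_initial_segment[of t "Suc i"] by (simp add: sums_iff)
    have "(4 / 3) ^ i / 4 = 4 ^ i * (1 / 3) ^ i / (4 :: real)" by (simp flip: power_mult_distrib)
    also have "\<dots> \<le> N i * (1 / 3) ^ i / 4"
      by (intro divide_right_mono mult_right_mono N) auto
    also have "\<dots> \<le> \<bar>\<integral>x. h i x * \<phi> x \<partial>M\<bar>" unfolding eq using head tail by linarith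
    finally show ?thesis .
  qed
  have "\<not> Bseq (\<lambda>n. \<integral>x. h n x * \<phi> x \<partial>M)"
  proof
    assume "Bseq (\<lambda>n. \<integral>x. h n x * \<phi> x \<partial>M)"
    then obtain K where "\<And>n. \<bar>\<integral>x. h n x * \<phi> x \<partial>M\<bar> \<le> K" by (auto simp: Bseq_def)
    then have "(4 / 3) ^ n / 4 \<le> K" for n using order_trans[OF large] by blast
    then have "(4 / 3) ^ n \<le> 4 * K" for n by (simp add: mult.commute)
    moreover obtain n where "4 * K < (4 / 3) ^ n" using real_arch_pow[of "4 / 3" "4 * K"] by auto
    ultimately show False by (meson not_less)
  qed
  with \<phi>_int show ?thesis by blast
qed

section \<open>Derivations\<close>

lemma derivation_measurable:
  "Lipschitz_derivation d M b \<Longrightarrow> f \<in> Lipb d \<Longrightarrow> b f \<in> borel_measurable M"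
  by (simp add: Lipschitz_derivation_def)

lemma derivation_add:
  "Lipschitz_derivation d M b \<Longrightarrow> f \<in> Lipb d \<Longrightarrow> g \<in> Lipb d \<Longrightarrow>
    AE x in M. b (\<lambda>y. f y + g y) x = b f x + b g x"
  by (simp add: Lipschitz_derivation_def)

lemma derivation_cmult:
  "Lipschitz_derivation d M b \<Longrightarrow> f \<in> Lipb d \<Longrightarrow> AE x in M. b (\<lambda>y. c * f y) x = c * b f x"
  by (simp add: Lipschitz_derivation_def)

lemma derivation_mult:
  "Lipschitz_derivation d M b \<Longrightarrow> f \<in> Lipb d \<Longrightarrow> g \<in> Lipb d \<Longrightarrow>
    AE x in M. b (\<lambda>y. f y * g y) x = f x * b g x + g x * b f x"
  by (simp add: Lipschitz_derivation_def)

lemma derivation_diff: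
  assumes d: "extended_distance d" and b: "Lipschitz_derivation d M b"
    and f: "f \<in> Lipb d" and g: "g \<in> Lipb d"
  shows "AE x in M. b (\<lambda>y. f y - g y) x = b f x - b g x"
proof -
  have "AE x in M. b (\<lambda>y. f y + (- 1) * g y) x = b f x + b (\<lambda>y. (- 1) * g y) x"
    by (rule derivation_add[OF b f Lipb_cmult[OF d g]])
  with derivation_cmult[OF b g, of "- 1"] show ?thesis by eventually_elim simp
qed

text \<open>The Leibniz rule for 1 = 1 * 1 gives b(1) = 2 b(1).\<close>

lemma derivation_const:
  assumes d: "extended_distance d" and b: "Lipschitz_derivation d M b"
  shows "AE x in M. b (\<lambda>y. c) x = 0"
  using derivation_mult[OF b Lipb_const[OF d] Lipb_const[OF d], of 1 1]
    derivation_cmult[OF b Lipb_const[OF d], of c 1]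
  by eventually_elim simp

section \<open>The two pointwise norms as attained essential infima\<close>

definition Weaver_bounds where
  "Weaver_bounds d M b =
    {g \<in> Linf_plus M. \<forall>f\<in>Lipb d. AE x in M. \<bar>b f x\<bar> \<le> g x * Lipb_norm d f}"

lemma Weaver_norm_eq: "Weaver_norm d M b = ess_inf M (Weaver_bounds d M b)"
  by (simp add: Weaver_norm_def Weaver_bounds_def)

lemma is_ess_inf_Weaver_norm:
  assumes "finite_measure M" and ne: "Weaver_bounds d M b \<noteq> {}"
  shows "is_ess_inf M (Weaver_bounds d M b) (Weaver_norm d M b)"
  unfolding Weaver_norm_eq
proof (rule is_ess_inf_exists[OF assms])
  fix g h assume g: "g \<in> Weaver_bounds d M b" and h: "h \<in> Weaver_bounds d M b"
  have [measurable]: "g \<in> borel_measurable M" "h \<in> borel_measurable M"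
    using g h by (auto simp: Weaver_bounds_def Linf_plus_def Linf_def)
  have nonneg: "AE x in M. 0 \<le> g x" "AE x in M. 0 \<le> h x"
    using g h by (auto simp: Weaver_bounds_def Linf_plus_def)
  obtain C where C: "AE x in M. \<bar>g x\<bar> \<le> C"
    using g by (auto simp: Weaver_bounds_def Linf_plus_def Linf_def)
  have "AE x in M. \<bar>min (g x) (h x)\<bar> \<le> C"
    using C nonneg by eventually_elim auto
  moreover have "AE x in M. 0 \<le> min (g x) (h x)"
    using nonneg by eventually_elim auto
  moreover have "AE x in M. \<bar>b f x\<bar> \<le> min (g x) (h x) * Lipb_norm d f" if f: "f \<in> Lipb d" for f
  proof -
    have "AE x in M. \<bar>b f x\<bar> \<le> g x * Lipb_norm d f" "AE x in M. \<bar>b f x\<bar> \<le> h x * Lipb_norm d f"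
      using f g h by (auto simp: Weaver_bounds_def)
    then show ?thesis by eventually_elim (auto simp: min_def)
  qed
  ultimately show "(\<lambda>x. min (g x) (h x)) \<in> Weaver_bounds d M b"
    unfolding Weaver_bounds_def Linf_plus_def Linf_def by auto
qed (auto simp: Weaver_bounds_def Linf_plus_def Linf_def)

text \<open>The infimum is attained: \<open>ess_inf_bound\<close> with the constant weight
  \<open>Lipb_norm d f\<close> passes each inequality to the infimum, which is bounded because it
  lies between 0 and a bounded member.\<close>

lemma Weaver_norm_in_Weaver_bounds:
  assumes M: "finite_measure M" and b: "Lipschitz_derivation d M b"
    and ne: "Weaver_bounds d M b \<noteq> {}"
  shows "Weaver_norm d M b \<in> Weaver_bounds d M b"
proof -
  note W = is_ess_inf_Weaver_norm[OF M ne]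
  have pos: "AE x in M. 0 \<le> g x" if "g \<in> Weaver_bounds d M b" for g
    using that by (simp add: Weaver_bounds_def Linf_plus_def)
  then have nonneg: "AE x in M. 0 \<le> Weaver_norm d M b x"
    using W by (simp add: is_ess_inf_def)
  obtain g where g: "g \<in> Weaver_bounds d M b" using ne by blast
  then obtain C where "AE x in M. \<bar>g x\<bar> \<le> C"
    by (auto simp: Weaver_bounds_def Linf_plus_def Linf_def)
  moreover have "AE x in M. Weaver_norm d M b x \<le> g x" using W g by (simp add: is_ess_inf_def)
  ultimately have "AE x in M. \<bar>Weaver_norm d M b x\<bar> \<le> C"
    using nonneg by eventually_elim auto
  moreover have "AE x in M. \<bar>b f x\<bar> \<le> Weaver_norm d M b x * Lipb_norm d f"
    if f: "f \<in> Lipb d" for f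
    using derivation_measurable[OF b f] f
    by (intro ess_inf_bound[OF W ne pos])
      (auto simp: Lipb_norm_nonneg Weaver_bounds_def intro: borel_measurable_abs)
  ultimately show ?thesis
    using nonneg W unfolding Weaver_bounds_def Linf_plus_def Linf_def is_ess_inf_def by blast
qed

lemma is_ess_inf_Der_norm:
  assumes "finite_measure M" and ne: "slope_bounds d M b \<noteq> {}"
  shows "is_ess_inf M (slope_bounds d M b) (Der_norm d M b)"
  unfolding Der_norm_def
proof (rule is_ess_inf_exists[OF assms])
  fix g h assume g: "g \<in> slope_bounds d M b" and h: "h \<in> slope_bounds d M b"
  have [measurable]: "g \<in> borel_measurable M" "h \<in> borel_measurable M"
    using g h by (auto simp: slope_bounds_def L0_plus_def)
  have "AE x in M. 0 \<le> g x" "AE x in M. 0 \<le> h x"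
    using g h by (auto simp: slope_bounds_def L0_plus_def)
  then have "AE x in M. 0 \<le> min (g x) (h x)" by eventually_elim auto
  moreover have "AE x in M. \<bar>b f x\<bar> \<le> min (g x) (h x) * asymp_slope d f x"
    if f: "f \<in> Lipb d" for f
  proof -
    have "AE x in M. \<bar>b f x\<bar> \<le> g x * asymp_slope d f x"
      "AE x in M. \<bar>b f x\<bar> \<le> h x * asymp_slope d f x"
      using f g h by (auto simp: slope_bounds_def)
    then show ?thesis by eventually_elim (auto simp: min_def)
  qed
  ultimately show "(\<lambda>x. min (g x) (h x)) \<in> slope_bounds d M b"
    unfolding slope_bounds_def L0_plus_def by auto
qed (auto simp: slope_bounds_def L0_plus_def)

text \<open>The same attainment, now with the nonconstant weight \<open>asymp_slope d f\<close>; its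
  measurability is what the division inside \<open>ess_inf_bound\<close> requires.\<close>

lemma Der_norm_in_slope_bounds:
  assumes M: "finite_Radon_measure M" and b: "b \<in> Der0 d M"
  shows "Der_norm d M b \<in> slope_bounds d M b"
proof -
  have fin: "finite_measure M" and sets: "sets M = sets borel"
    using M by (auto simp: finite_Radon_measure_def)
  have ne: "slope_bounds d M b \<noteq> {}" and der: "Lipschitz_derivation d M b"
    using b by (auto simp: Der0_def)
  note W = is_ess_inf_Der_norm[OF fin ne]
  have pos: "AE x in M. 0 \<le> g x" if "g \<in> slope_bounds d M b" for g
    using that by (simp add: slope_bounds_def L0_plus_def)
  then have nonneg: "AE x in M. 0 \<le> Der_norm d M b x"
    using W by (simp add: is_ess_inf_def)
  have "AE x in M. \<bar>b f x\<bar> \<le> Der_norm d M b x * asymp_slope d f x" if f: "f \<in> Lipb d" for f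
  proof (rule ess_inf_bound[OF W ne pos])
    show "asymp_slope d f \<in> borel_measurable M"
      using borel_measurable_asymp_slope[OF f] measurable_cong_sets[OF sets refl] by blast
    show "(\<lambda>x. \<bar>b f x\<bar>) \<in> borel_measurable M"
      using derivation_measurable[OF der f] by measurable
  qed (use f in \<open>auto simp: asymp_slope_nonneg slope_bounds_def\<close>)
  then show ?thesis
    using nonneg W unfolding slope_bounds_def L0_plus_def is_ess_inf_def by blast
qed

text \<open>The slope never exceeds the global Lipschitz constant, hence never the norm, so a
  bounded slope bound is also a Weaver bound. The easy inequality between the two norms
  follows.\<close>

lemma Der_norm_in_Weaver_bounds:
  assumes M: "finite_Radon_measure M" and b: "b \<in> Der_inf d M"
  shows "Der_norm d M b \<in> Weaver_bounds d M b"
proof -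
  have D: "Der_norm d M b \<in> slope_bounds d M b"
    by (rule Der_norm_in_slope_bounds[OF M]) (use b in \<open>simp add: Der_inf_def\<close>)
  have nonneg: "AE x in M. 0 \<le> Der_norm d M b x"
    using D by (simp add: slope_bounds_def L0_plus_def)
  have "AE x in M. \<bar>b f x\<bar> \<le> Der_norm d M b x * Lipb_norm d f" if f: "f \<in> Lipb d" for f
  proof -
    have "AE x in M. \<bar>b f x\<bar> \<le> Der_norm d M b x * asymp_slope d f x"
      using D f by (simp add: slope_bounds_def)
    then show ?thesis using nonneg
    proof eventually_elim
      case (elim x)
      then show ?case
        using mult_left_mono[OF asymp_slope_le_Lipb_norm[OF f, of x] elim(2)] by linarith
    qed
  qed
  then show ?thesis
    using nonneg b by (simp add: Weaver_bounds_def Linf_plus_def Der_inf_def)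
qed

lemma Weaver_norm_le_Der_norm:
  assumes M: "finite_Radon_measure M" and b: "b \<in> Der_inf d M"
  shows "AE x in M. Weaver_norm d M b x \<le> Der_norm d M b x"
proof -
  have "finite_measure M" using M by (simp add: finite_Radon_measure_def)
  then have "is_ess_inf M (Weaver_bounds d M b) (Weaver_norm d M b)"
    by (rule is_ess_inf_Weaver_norm) (use Der_norm_in_Weaver_bounds[OF assms] in blast)
  then show ?thesis using Der_norm_in_Weaver_bounds[OF assms] by (simp add: is_ess_inf_def)
qed

text \<open>Against a test function in \<^term>\<open>Lipb d\<close>, integration by parts moves the derivation away from
  the convergent sequence; density of \<^term>\<open>Lipb d\<close> in \<open>L\<^sup>1\<close> does the rest.\<close>

lemma Der_inf_1_subset_Weaver_derivations:
  fixes d :: "'a::t2_space \<Rightarrow> 'a \<Rightarrow> ennreal"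
  assumes S: "ext_metric_top_measure_space d M" and b: "b \<in> Der_inf_1 d M"
  shows "b \<in> Weaver_derivations d M"
proof -
  have M: "finite_Radon_measure M" and d: "extended_distance d"
    using S by (auto simp: ext_metric_top_measure_space_def ext_metric_top_space_def)
  interpret finite_measure M using M by (simp add: finite_Radon_measure_def)
  have bi: "b \<in> Der_inf d M" and der: "Lipschitz_derivation d M b" and div: "has_divergence d M b"
    using b by (auto simp: Der_inf_1_def Der_inf_def Der0_def)
  have D: "Der_norm d M b \<in> Weaver_bounds d M b" by (rule Der_norm_in_Weaver_bounds[OF M bi])
  then obtain C0 where "AE x in M. \<bar>Der_norm d M b x\<bar> \<le> C0"
    by (auto simp: Weaver_bounds_def Linf_plus_def Linf_def)
  moreover define C where "C = max 0 C0"
  ultimately have C: "0 \<le> C" "AE x in M. \<bar>Der_norm d M b x\<bar> \<le> C" by (auto elim!: eventually_mono)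
  have bound: "AE x in M. \<bar>b f x\<bar> \<le> C * Lipb_norm d f" if f: "f \<in> Lipb d" for f
  proof -
    have "AE x in M. \<bar>b f x\<bar> \<le> Der_norm d M b x * Lipb_norm d f"
      using D f by (simp add: Weaver_bounds_def)
    then show ?thesis using C(2)
    proof eventually_elim
      case (elim x)
      then have "Der_norm d M b x * Lipb_norm d f \<le> C * Lipb_norm d f"
        by (intro mult_right_mono Lipb_norm_nonneg[OF f]) auto
      with elim show ?case by linarith
    qed
  qed
  note meas [measurable] = derivation_measurable[OF der]
  obtain D where D: "integrable M D"
    "\<And>f. f \<in> Lipb d \<Longrightarrow> (\<integral>x. b f x \<partial>M) = - (\<integral>x. f x * D x \<partial>M)"
    and bint: "\<And>f. f \<in> Lipb d \<Longrightarrow> integrable M (b f)"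
    using div by (auto simp: has_divergence_def)
  have "weak_star_tendsto M (\<lambda>n. b (f n)) (b f0)"
    if f: "\<And>n. f n \<in> Lipb d" "\<And>n. Lipb_norm d (f n) \<le> 1"
      and f0: "f0 \<in> Lipb d" "Lipb_norm d f0 \<le> 1" and lim: "\<And>x. (\<lambda>n. f n x) \<longlonglongrightarrow> f0 x" for f f0
  proof (rule weak_star_tendsto_Lipb[OF S])
    have bC: "AE x in M. \<bar>b u x\<bar> \<le> C" if u: "u \<in> Lipb d" "Lipb_norm d u \<le> 1" for u
      using bound[OF u(1)]
    proof eventually_elim
      case (elim x)
      then show ?case using mult_left_mono[OF u(2) C(1)] by simp
    qed
    show "AE x in M. \<bar>b (f n) x\<bar> \<le> C" for n by (rule bC[OF f])
    show "AE x in M. \<bar>b f0 x\<bar> \<le> C" by (rule bC[OF f0])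
    show "0 \<le> C" by (rule C)
    show "b (f n) \<in> borel_measurable M" for n by (rule meas[OF f(1)])
    show "b f0 \<in> borel_measurable M" by (rule meas[OF f0(1)])
    fix \<phi> assume \<phi>: "\<phi> \<in> Lipb d"
    \<comment> \<open>Leibniz writes b(u) \<phi> as b(u \<phi>) - u b(\<phi>), and the divergence
      removes the derivation from u \<phi>. What remains pairs \<open>u\<close> with this fixed
      integrable \<open>w\<close>, so pointwise convergence in the unit ball suffices by dominated
      convergence.\<close>
    define w where "w x = \<phi> x * D x + b \<phi> x" for x
    have bm: "integrable M (\<lambda>x. u x * g x)" if "u \<in> Lipb d" "integrable M g" for u g
    proof (rule Bochner_Integration.integrable_bound[of M "\<lambda>x. Lipb_norm d u * g x"])
      show "AE x in M. norm (u x * g x) \<le> norm (Lipb_norm d u * g x)"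
        using abs_le_Lipb_norm[OF that(1)] Lipb_norm_nonneg[OF that(1)]
        by (auto simp: abs_mult intro!: mult_right_mono)
    qed (use that borel_measurable_Lipb[OF M that(1)] in auto)
    have w: "integrable M w" unfolding w_def
      by (intro Bochner_Integration.integrable_add bm \<phi> D bint)
    have parts: "(\<integral>x. b u x * \<phi> x \<partial>M) = - (\<integral>x. u x * w x \<partial>M)" if u: "u \<in> Lipb d" for u
    proof -
      note u\<phi> = Lipb_mult[OF d u \<phi>]
      have "(\<integral>x. b u x * \<phi> x \<partial>M) = (\<integral>x. b (\<lambda>y. u y * \<phi> y) x - u x * b \<phi> x \<partial>M)"
      proof (rule integral_cong_AE)
        show "AE x in M. b u x * \<phi> x = b (\<lambda>y. u y * \<phi> y) x - u x * b \<phi> x"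
          using derivation_mult[OF der u \<phi>] by eventually_elim simp
      qed (use borel_measurable_Lipb[OF M u] borel_measurable_Lipb[OF M \<phi>] meas[OF u] meas[OF \<phi>]
             meas[OF u\<phi>] in measurable)
      also have "\<dots> = - (\<integral>x. u x * \<phi> x * D x \<partial>M) - (\<integral>x. u x * b \<phi> x \<partial>M)"
        by (subst Bochner_Integration.integral_diff) (auto intro!: bint bm u \<phi> u\<phi> simp: D(2)[OF u\<phi>])
      also have "\<dots> = - (\<integral>x. u x * \<phi> x * D x + u x * b \<phi> x \<partial>M)"
        by (subst Bochner_Integration.integral_add) (auto intro!: bint bm u \<phi> u\<phi> D(1))
      finally show ?thesis by (simp add: w_def algebra_simps)
    qed
    have "(\<lambda>n. \<integral>x. f n x * w x \<partial>M) \<longlonglongrightarrow> (\<integral>x. f0 x * w x \<partial>M)"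
    proof (rule integral_dominated_convergence[where w = "\<lambda>x. \<bar>w x\<bar>"])
      show "AE x in M. (\<lambda>n. f n x * w x) \<longlonglongrightarrow> f0 x * w x"
        by (intro AE_I2 tendsto_mult lim tendsto_const)
      show "AE x in M. norm (f n x * w x) \<le> \<bar>w x\<bar>" for n
      proof (rule AE_I2)
        fix x
        have "\<bar>f n x\<bar> \<le> 1" using abs_le_Lipb_norm[OF f(1)[of n], of x] f(2)[of n] by linarith
        then show "norm (f n x * w x) \<le> \<bar>w x\<bar>"
          using mult_right_mono[of "\<bar>f n x\<bar>" 1 "\<bar>w x\<bar>"] by (simp add: abs_mult)
      qed
    qed (use w bm[OF f(1) w] bm[OF f0(1) w] in auto)
    then show "(\<lambda>n. \<integral>x. b (f n) x * \<phi> x \<partial>M) \<longlonglongrightarrow> (\<integral>x. b f0 x * \<phi> x \<partial>M)"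
      unfolding parts[OF f(1)] parts[OF f0(1)] by (rule tendsto_minus)
  qed
  moreover have "b f \<in> Linf M" if "f \<in> Lipb d" for f
    using bound[OF that] meas[OF that] by (auto simp: Linf_def)
  ultimately show ?thesis using der unfolding Weaver_derivations_def by blast
qed

section \<open>Weaver derivations\<close>

text \<open>Without a uniform constant there would be a sequence converging to 0 in norm whose
  images grow geometrically in \<open>L^\<infinity>\<close>. Its images converge weakly-star, so
  each test function has bounded pairings, contrary to \<open>unbounded_pairing\<close>.\<close>

lemma Weaver_bounds_nonempty:
  fixes d :: "'a::t2_space \<Rightarrow> 'a \<Rightarrow> ennreal"
  assumes S: "ext_metric_top_measure_space d M" and b: "b \<in> Weaver_derivations d M"
  shows "Weaver_bounds d M b \<noteq> {}"
proof -
  have M: "finite_Radon_measure M" and d: "extended_distance d"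
    using S by (auto simp: ext_metric_top_measure_space_def ext_metric_top_space_def)
  have fin: "finite_measure M" using M by (simp add: finite_Radon_measure_def)
  have der: "Lipschitz_derivation d M b" and inf: "\<And>f. f \<in> Lipb d \<Longrightarrow> b f \<in> Linf M"
    and cont: "\<And>f f0. (\<And>n. f n \<in> Lipb d \<and> Lipb_norm d (f n) \<le> 1) \<Longrightarrow>
       f0 \<in> Lipb d \<Longrightarrow> Lipb_norm d f0 \<le> 1 \<Longrightarrow> (\<And>x. (\<lambda>n. f n x) \<longlonglongrightarrow> f0 x) \<Longrightarrow>
       weak_star_tendsto M (\<lambda>n. b (f n)) (b f0)"
    using b by (auto simp: Weaver_derivations_def)
  have "\<exists>C\<ge>0. \<forall>f\<in>Lipb d. AE x in M. \<bar>b f x\<bar> \<le> C * Lipb_norm d f"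
  proof (rule ccontr)
    assume "\<not> ?thesis"
    then have "\<exists>f\<in>Lipb d. \<not> (AE x in M. \<bar>b f x\<bar> \<le> 8 ^ n * Lipb_norm d f)" for n :: nat
      by (meson zero_le_numeral zero_le_power)
    then obtain f where f: "\<And>n. f n \<in> Lipb d"
      "\<And>n. \<not> (AE x in M. \<bar>b (f n) x\<bar> \<le> 8 ^ n * Lipb_norm d (f n))" by metis
    have pos: "0 < Lipb_norm d (f n)" for n
    proof (rule ccontr)
      assume "\<not> 0 < Lipb_norm d (f n)"
      then have 0: "Lipb_norm d (f n) = 0" using Lipb_norm_nonneg[OF f(1)[of n]] by linarith
      then have "f n = (\<lambda>x. 0)" by (rule Lipb_norm_eq_0[OF f(1)])
      then have "AE x in M. b (f n) x = 0" using derivation_const[OF d der, of 0] by simp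
      with f(2)[of n] 0 show False by (auto elim: eventually_mono)
    qed
    \<comment> \<open>Rescaling to norm at most \<open>(1 / 2) ^ n\<close> forces convergence to 0
      and turns the violated bound \<open>8 ^ n\<close> into the violated bound \<open>4 ^ n\<close>
      that \<open>unbounded_pairing\<close> asks for.\<close>
    define c where "c n = (1 / 2) ^ n / Lipb_norm d (f n)" for n
    have c: "0 < c n" for n using pos by (simp add: c_def)
    define u where "u n = (\<lambda>x. c n * f n x)" for n
    have u: "u n \<in> Lipb d" for n unfolding u_def by (rule Lipb_cmult[OF d f(1)])
    have u_norm: "Lipb_norm d (u n) \<le> (1 / 2) ^ n" for n
    proof -
      have "Lipb_norm d (u n) \<le> \<bar>c n\<bar> * Lipb_norm d (f n)"
        unfolding u_def by (rule Lipb_norm_cmult_le[OF d f(1)])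
      also have "\<dots> = (1 / 2) ^ n" using c[of n] pos[of n] by (simp add: c_def)
      finally show ?thesis .
    qed
    have "weak_star_tendsto M (\<lambda>n. b (u n)) (b (\<lambda>x. 0))"
    proof (rule cont)
      show "u n \<in> Lipb d \<and> Lipb_norm d (u n) \<le> 1" for n
        using u u_norm[of n] power_le_one[of "1 / 2 :: real" n] by auto
      show "(\<lambda>x. 0) \<in> Lipb d" by (rule Lipb_const[OF d])
      show "Lipb_norm d (\<lambda>x. 0) \<le> 1" using Lipb_norm_le[OF d, of "\<lambda>x. 0" 0 0] by simp
      show "(\<lambda>n. u n x) \<longlonglongrightarrow> 0" for x
      proof (rule Lim_null_comparison)
        show "\<forall>\<^sub>F n in sequentially. norm (u n x) \<le> (1 / 2) ^ n"
          using order_trans[OF abs_le_Lipb_norm[OF u] u_norm] by simp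
      qed (rule LIMSEQ_power_zero, simp)
    qed
    then have "Bseq (\<lambda>n. \<integral>x. b (u n) x * \<phi> x \<partial>M)" if "integrable M \<phi>" for \<phi>
      using that unfolding weak_star_tendsto_def by (intro convergent_imp_Bseq convergentI) blast
    moreover have "\<not> (AE x in M. \<bar>b (u n) x\<bar> \<le> 4 ^ n)" for n
    proof
      assume "AE x in M. \<bar>b (u n) x\<bar> \<le> 4 ^ n"
      with derivation_cmult[OF der f(1)[of n], of "c n"]
      have "AE x in M. \<bar>b (f n) x\<bar> \<le> 8 ^ n * Lipb_norm d (f n)"
      proof eventually_elim
        case (elim x)
        then have "c n * \<bar>b (f n) x\<bar> \<le> 4 ^ n" using c[of n] by (simp add: u_def abs_mult)
        then have "\<bar>b (f n) x\<bar> \<le> 4 ^ n / c n" using c[of n] by (simp add: field_simps)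
        also have "4 ^ n / c n = 8 ^ n * Lipb_norm d (f n)"
        proof -
          have "(8::real) ^ n = 4 ^ n * 2 ^ n" by (simp flip: power_mult_distrib)
          then show ?thesis by (simp add: c_def power_divide)
        qed
        finally show ?case .
      qed
      with f(2) show False by blast
    qed
    ultimately show False
      using unbounded_pairing[OF fin, of "\<lambda>n. b (u n)"] inf[OF u] by blast
  qed
  then obtain C where "0 \<le> C" "\<forall>f\<in>Lipb d. AE x in M. \<bar>b f x\<bar> \<le> C * Lipb_norm d f" by blast
  then have "(\<lambda>x. C) \<in> Weaver_bounds d M b"
    by (auto simp: Weaver_bounds_def Linf_plus_def Linf_def)
  then show ?thesis by blast
qed

text \<open>Truncating \<open>f\<close> near its zero set gives functions that vanish there to second order, so that the
  Leibniz rule applies to them; they converge to \<open>f\<close> without increasing the norm.\<close>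

lemma Weaver_derivation_local:
  fixes d :: "'a::t2_space \<Rightarrow> 'a \<Rightarrow> ennreal"
  assumes S: "ext_metric_top_measure_space d M" and b: "b \<in> Weaver_derivations d M"
    and f: "f \<in> Lipb d"
  shows "AE x in M. f x = 0 \<longrightarrow> b f x = 0"
proof -
  have M: "finite_Radon_measure M" and d: "extended_distance d"
    using S by (auto simp: ext_metric_top_measure_space_def ext_metric_top_space_def)
  interpret finite_measure M using M by (simp add: finite_Radon_measure_def)
  have der: "Lipschitz_derivation d M b" and inf: "\<And>f. f \<in> Lipb d \<Longrightarrow> b f \<in> Linf M"
    and cont: "\<And>f f0. (\<And>n. f n \<in> Lipb d \<and> Lipb_norm d (f n) \<le> 1) \<Longrightarrow>
       f0 \<in> Lipb d \<Longrightarrow> Lipb_norm d f0 \<le> 1 \<Longrightarrow> (\<And>x. (\<lambda>n. f n x) \<longlonglongrightarrow> f0 x) \<Longrightarrow>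
       weak_star_tendsto M (\<lambda>n. b (f n)) (b f0)"
    using b by (auto simp: Weaver_derivations_def)
  have unit: "AE x in M. f x = 0 \<longrightarrow> b f x = 0" if f: "f \<in> Lipb d" "Lipb_norm d f \<le> 1" for f
  proof -
    have [measurable]: "f \<in> borel_measurable M" "b f \<in> borel_measurable M"
      using borel_measurable_Lipb[OF M f(1)] derivation_measurable[OF der f(1)] by auto
    \<comment> \<open>Soft thresholding at \<open>1 / Suc n\<close>: 1-Lipschitz and at most |t| in
      absolute value, so composing with it stays in the unit ball. The factor
      \<open>\<rho> n\<close> is 1 off the threshold interval and 0 at 0, so \<open>\<phi> n\<close>
      is a product of two functions vanishing at 0.\<close>
    define \<phi> where "\<phi> n t = max (t - 1 / Suc n) 0 + min (t + 1 / Suc n) 0" for n :: nat and t :: real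
    define \<rho> where "\<rho> n t = min 1 (Suc n * \<bar>t\<bar>)" for n :: nat and t :: real
    have \<phi>_lip: "\<bar>\<phi> n s - \<phi> n t\<bar> \<le> \<bar>s - t\<bar>" for n s t
    proof -
      have "0 < 1 / real (Suc n)" by simp
      then show ?thesis unfolding \<phi>_def by linarith
    qed
    have \<phi>_abs: "\<bar>\<phi> n t\<bar> \<le> \<bar>t\<bar>" for n t using \<phi>_lip[of n t 0] by (simp add: \<phi>_def)
    have \<rho>_lip: "\<bar>\<rho> n s - \<rho> n t\<bar> \<le> Suc n * \<bar>s - t\<bar>" for n and s t :: real
    proof -
      have "\<bar>\<rho> n s - \<rho> n t\<bar> \<le> \<bar>Suc n * \<bar>s\<bar> - Suc n * \<bar>t\<bar>\<bar>" unfolding \<rho>_def by linarith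
      also have "\<dots> = Suc n * \<bar>\<bar>s\<bar> - \<bar>t\<bar>\<bar>"
        by (simp only: right_diff_distrib[symmetric] abs_mult abs_of_nat)
      also have "\<dots> \<le> Suc n * \<bar>s - t\<bar>" by (rule mult_left_mono) auto
      finally show ?thesis .
    qed
    have \<phi>\<rho>: "\<phi> n t * \<rho> n t = \<phi> n t" for n t
    proof (cases "1 / Suc n \<le> \<bar>t\<bar>")
      case True
      then have "1 \<le> Suc n * \<bar>t\<bar>" by (simp add: pos_divide_le_eq mult.commute)
      then show ?thesis by (simp add: \<rho>_def)
    next
      case False
      then have "\<phi> n t = 0" unfolding \<phi>_def by linarith
      then show ?thesis by simp
    qed
    have vanish: "\<phi> n 0 = 0" "\<rho> n 0 = 0" for n by (simp_all add: \<phi>_def \<rho>_def)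
    have \<phi>f: "(\<lambda>x. \<phi> n (f x)) \<in> Lipb d" for n
      by (rule Lipb_compose[OF d f(1), where C = 1]) (simp add: \<phi>_lip)
    have \<rho>f: "(\<lambda>x. \<rho> n (f x)) \<in> Lipb d" for n
      by (rule Lipb_compose[OF d f(1) \<rho>_lip])
    have zero: "AE x in M. f x = 0 \<longrightarrow> b (\<lambda>x. \<phi> n (f x)) x = 0" for n
      using derivation_mult[OF der \<phi>f \<rho>f, of n n] unfolding \<phi>\<rho>
    proof eventually_elim
      case (elim x)
      show ?case
      proof
        assume "f x = 0"
        show "b (\<lambda>x. \<phi> n (f x)) x = 0" by (subst elim) (simp add: \<open>f x = 0\<close> vanish)
      qed
    qed
    have conv: "weak_star_tendsto M (\<lambda>n. b (\<lambda>x. \<phi> n (f x))) (b f)"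
    proof (rule cont)
      show "(\<lambda>x. \<phi> n (f x)) \<in> Lipb d \<and> Lipb_norm d (\<lambda>x. \<phi> n (f x)) \<le> 1" for n
      proof
        have "Lipb_norm d (\<lambda>x. \<phi> n (f x)) \<le> enn2real (Lip d UNIV f) + (SUP x. \<bar>f x\<bar>)"
          by (rule Lipb_norm_le[OF d])
            (use order_trans[OF \<phi>_abs Lipb_abs_le_SUP[OF f(1)]]
              order_trans[OF \<phi>_lip Lipb_Lip[OF d f(1)]] in auto)
        then show "Lipb_norm d (\<lambda>x. \<phi> n (f x)) \<le> 1" using f(2) by (simp add: Lipb_norm_def)
      qed (rule \<phi>f)
      show "(\<lambda>n. \<phi> n (f x)) \<longlonglongrightarrow> f x" for x
      proof (rule LIM_zero_cancel, rule Lim_null_comparison)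
        have "\<bar>\<phi> n t - t\<bar> \<le> 1 / Suc n" for n t
        proof -
          have "0 < 1 / real (Suc n)" by simp
          then show ?thesis unfolding \<phi>_def by linarith
        qed
        then show "\<forall>\<^sub>F n in sequentially. norm (\<phi> n (f x) - f x) \<le> 1 / Suc n" by simp
        show "(\<lambda>n. 1 / Suc n) \<longlonglongrightarrow> (0::real)" by (rule LIMSEQ_Suc[OF lim_1_over_n])
      qed
    qed (use f in auto)
    \<comment> \<open>Pairing \<open>b f\<close> with this \<open>\<psi>\<close> integrates |b f|
      over the zero set of \<open>f\<close>, while the approximants pair to 0 because their images
      vanish there.\<close>
    define \<psi> where "\<psi> x = sgn (b f x) * indicat_real {x. f x = 0} x" for x
    have \<psi>_int: "integrable M \<psi>"
    proof (rule integrable_const_bound[of _ 1])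
      have "norm (\<psi> x) \<le> 1" for x by (simp add: \<psi>_def abs_mult indicator_def abs_sgn_eq)
      then show "AE x in M. norm (\<psi> x) \<le> 1" by simp
      show "\<psi> \<in> borel_measurable M" unfolding \<psi>_def indicator_def by measurable
    qed
    have "(\<integral>x. b (\<lambda>x. \<phi> n (f x)) x * \<psi> x \<partial>M) = 0" for n
    proof (rule integral_eq_zero_AE)
      show "AE x in M. b (\<lambda>x. \<phi> n (f x)) x * \<psi> x = 0"
        using zero[of n] by eventually_elim (auto simp: \<psi>_def indicator_def)
    qed
    moreover have "(\<lambda>n. \<integral>x. b (\<lambda>x. \<phi> n (f x)) x * \<psi> x \<partial>M) \<longlonglongrightarrow> (\<integral>x. b f x * \<psi> x \<partial>M)"
      using conv \<psi>_int unfolding weak_star_tendsto_def by blast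
    ultimately have int0: "(\<integral>x. b f x * \<psi> x \<partial>M) = 0"
      by (simp add: LIMSEQ_const_iff)
    have b\<psi>: "b f x * \<psi> x = \<bar>b f x\<bar> * indicat_real {x. f x = 0} x" for x
      by (simp add: \<psi>_def abs_sgn mult.assoc)
    obtain C where C: "AE x in M. \<bar>b f x\<bar> \<le> C" using inf[OF f(1)] by (auto simp: Linf_def)
    have "integrable M (\<lambda>x. b f x * \<psi> x)"
    proof (rule integrable_const_bound[of _ C])
      show "AE x in M. norm (b f x * \<psi> x) \<le> C"
        unfolding b\<psi> using C by eventually_elim (auto simp: indicator_def)
      show "(\<lambda>x. b f x * \<psi> x) \<in> borel_measurable M" using \<psi>_int by measurable
    qed
    moreover have "AE x in M. 0 \<le> b f x * \<psi> x" unfolding b\<psi> by simp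
    ultimately have "AE x in M. b f x * \<psi> x = 0"
      using int0 by (simp add: integral_nonneg_eq_0_iff_AE)
    then show ?thesis by eventually_elim (auto simp: b\<psi> indicator_def)
  qed
  \<comment> \<open>Rescaling into the unit ball, where the continuity of \<open>b\<close> is
    available; the \<open>1 +\<close> avoids dividing by a zero norm.\<close>
  define c where "c = 1 / (1 + Lipb_norm d f)"
  have c: "0 < c" using Lipb_norm_nonneg[OF f] by (simp add: c_def)
  have "Lipb_norm d (\<lambda>x. c * f x) \<le> c * Lipb_norm d f"
    using Lipb_norm_cmult_le[OF d f, of c] c by simp
  also have "\<dots> \<le> 1" using Lipb_norm_nonneg[OF f] by (simp add: c_def)
  finally have "AE x in M. c * f x = 0 \<longrightarrow> b (\<lambda>x. c * f x) x = 0"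
    by (rule unit[OF Lipb_cmult[OF d f]])
  with derivation_cmult[OF der f, of c] show ?thesis
    by eventually_elim (use c in auto)
qed

text \<open>Clamping \<open>f - f x\<close> between \<open>\<plusminus> k \<eta>\<close>, where \<open>\<eta>\<close> is a cutoff supported in \<open>U\<close> and \<open>k\<close> is small,
  changes nothing near \<open>x\<close> but yields a global function whose norm is close to \<open>Lip d U f\<close>.\<close>

lemma Lipb_localise:
  fixes d :: "'a::t2_space \<Rightarrow> 'a \<Rightarrow> ennreal"
  assumes T: "ext_metric_top_space d" and f: "f \<in> Lipb d" and "0 < q"
    and U: "open U" "x \<in> U" "Lip d U f < ennreal q"
  obtains g V where "g \<in> Lipb d" "Lipb_norm d g \<le> q" "open V" "x \<in> V"
    "\<And>y. y \<in> V \<Longrightarrow> g y = f y - f x"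
proof -
  have d: "extended_distance d" using T by (simp add: ext_metric_top_space_def)
  obtain \<eta> where \<eta>: "\<eta> \<in> Lipb d" "\<eta> x = 1" "\<And>y. 0 \<le> \<eta> y" "\<And>y. \<eta> y \<le> 1"
    "\<And>y. y \<notin> U \<Longrightarrow> \<eta> y = 0"
    using Lipb_cutoff[OF T U(1,2)] by metis
  obtain L where L: "0 \<le> L" "Lip d U f = ennreal L"
    using U(3) by (cases "Lip d U f") auto
  then have "L < q" using U(3) by (simp add: ennreal_less_iff)
  have f_lip: "\<bar>f y - f z\<bar> \<le> L * enn2real (d y z)" if "y \<in> U" "z \<in> U" "d y z < top" for y z
    using Lip_le_iff[OF d L(1), of U f] L(2) that by simp
  define E where "E = enn2real (Lip d UNIV \<eta>)"
  have "0 \<le> E" by (simp add: E_def)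
  \<comment> \<open>Solves \<open>k * E + k = q - L\<close>. Both \<open>L\<close> and the constant
    \<open>k * E\<close> of the barriers are then at most \<open>q - k\<close>, leaving exactly
    \<open>k\<close> for the supremum of \<open>g\<close>.\<close>
  define k where "k = (q - L) / (1 + E)"
  have "0 < k" using \<open>L < q\<close> \<open>0 \<le> E\<close> by (simp add: k_def)
  have "k * (1 + E) = q - L" using \<open>0 \<le> E\<close> by (simp add: k_def)
  then have kE: "k * E + k = q - L" by (simp add: algebra_simps)
  moreover have "0 \<le> k * E" using \<open>0 < k\<close> \<open>0 \<le> E\<close> by simp
  ultimately have kq: "L \<le> q - k" "k * E \<le> q - k" using L(1) by linarith+
  have k_lip: "\<bar>k * \<eta> y - k * \<eta> z\<bar> \<le> (q - k) * enn2real (d y z)" if "d y z < top" for y z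
  proof -
    have "\<bar>k * \<eta> y - k * \<eta> z\<bar> = k * \<bar>\<eta> y - \<eta> z\<bar>"
      using \<open>0 < k\<close> by (simp add: abs_mult flip: right_diff_distrib)
    also have "\<dots> \<le> k * (E * enn2real (d y z))"
      using Lipb_Lip[OF d \<eta>(1) that] \<open>0 < k\<close> by (intro mult_left_mono) (auto simp: E_def)
    also have "\<dots> \<le> (q - k) * enn2real (d y z)"
      using mult_right_mono[OF kq(2), of "enn2real (d y z)"] by (simp add: mult.assoc)
    finally show ?thesis .
  qed
  define g where "g y = max (min (f y - f x) (k * \<eta> y)) (- (k * \<eta> y))" for y
  have k\<eta>: "0 \<le> k * \<eta> y" "k * \<eta> y \<le> k" for y
    using \<open>0 < k\<close> \<eta>(3,4)[of y] by (auto simp: mult_le_cancel_left1)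
  have g_abs: "\<bar>g y\<bar> \<le> k * \<eta> y" for y unfolding g_def using k\<eta>(1)[of y] by linarith
  \<comment> \<open>Inside \<open>U\<close> the three clamped functions share the constant
    \<open>q - k\<close>, which \<open>max\<close> and \<open>min\<close> preserve. If a point lies
    outside \<open>U\<close>, then \<open>g\<close> and \<open>\<eta>\<close> vanish there and the
    barrier alone controls the other value, so \<open>f\<close> is never compared across the
    boundary of \<open>U\<close>.\<close>
  have g_lip: "\<bar>g y - g z\<bar> \<le> (q - k) * enn2real (d y z)" if yz: "d y z < top" for y z
  proof (cases "y \<in> U \<and> z \<in> U")
    case True
    then have "\<bar>f y - f z\<bar> \<le> (q - k) * enn2real (d y z)"
      using f_lip[of y z] yz mult_right_mono[OF kq(1), of "enn2real (d y z)"] by auto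
    with k_lip[OF yz] show ?thesis
      unfolding g_def using k\<eta>(1)[of y] k\<eta>(1)[of z] by linarith
  next
    case False
    then have "\<eta> y = 0 \<or> \<eta> z = 0" using \<eta>(5) by blast
    then show ?thesis
    proof
      assume "\<eta> y = 0"
      then show ?thesis using k_lip[OF yz] g_abs[of y] g_abs[of z] by simp
    next
      assume "\<eta> z = 0"
      then show ?thesis using k_lip[OF yz] g_abs[of y] g_abs[of z] by simp
    qed
  qed
  have g_le: "\<bar>g y\<bar> \<le> k" for y using g_abs[of y] k\<eta>(2)[of y] by linarith
  have qk: "0 \<le> q - k" using kq(1) L(1) by linarith
  have cont: "continuous_on UNIV f" "continuous_on UNIV \<eta>" using f \<eta>(1) by (auto simp: Lipb_def)
  show ?thesis
  proof (rule that)
    show "g \<in> Lipb d"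
    proof (rule LipbI[OF d _ g_le qk g_lip])
      show "continuous_on UNIV g" unfolding g_def by (intro continuous_intros cont)
    qed
    show "Lipb_norm d g \<le> q" using Lipb_norm_le[OF d g_le qk g_lip] by simp
    show "open {y. \<bar>f y - f x\<bar> < k * \<eta> y}"
      by (intro open_Collect_less continuous_intros cont)
    show "x \<in> {y. \<bar>f y - f x\<bar> < k * \<eta> y}" using \<eta>(2) \<open>0 < k\<close> by simp
    show "g y = f y - f x" if "y \<in> {y. \<bar>f y - f x\<bar> < k * \<eta> y}" for y
      using that unfolding g_def by auto
  qed
qed

text \<open>Where the slope is below \<open>q\<close>, \<open>f\<close> agrees locally, up to a
  constant, with some \<open>g\<close> of norm at most \<open>q\<close>. Locality gives
  \<open>b f = b g\<close> there, and the Weaver bound for \<open>g\<close> reads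
  \<open>\<bar>b f y\<bar> \<le> W y * q\<close>. Letting \<open>q\<close> decrease to the slope at
  each point finishes the estimate.\<close>

lemma Weaver_norm_in_slope_bounds:
  fixes d :: "'a::t2_space \<Rightarrow> 'a \<Rightarrow> ennreal"
  assumes S: "ext_metric_top_measure_space d M" and b: "b \<in> Weaver_derivations d M"
  shows "Weaver_norm d M b \<in> slope_bounds d M b"
proof -
  have M: "finite_Radon_measure M" and T: "ext_metric_top_space d" and d: "extended_distance d"
    using S by (auto simp: ext_metric_top_measure_space_def ext_metric_top_space_def)
  have fin: "finite_measure M" and sets: "sets M = sets borel"
    using M by (auto simp: finite_Radon_measure_def)
  have der: "Lipschitz_derivation d M b" using b by (simp add: Weaver_derivations_def)
  define W where "W = Weaver_norm d M b"
  have W: "W \<in> Weaver_bounds d M b"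
    unfolding W_def
    by (rule Weaver_norm_in_Weaver_bounds[OF fin der Weaver_bounds_nonempty[OF S b]])
  have W_nonneg: "AE x in M. 0 \<le> W x" and W_meas: "W \<in> borel_measurable M"
    using W by (auto simp: Weaver_bounds_def Linf_plus_def Linf_def)
  have "AE x in M. \<bar>b f x\<bar> \<le> W x * asymp_slope d f x" if f: "f \<in> Lipb d" for f
  proof -
    have level: "AE y in M. y \<in> {x. asymp_slope d f x < q} \<longrightarrow> \<bar>b f y\<bar> \<le> W y * q" if "0 < q" for q
    proof (rule Radon_AE_local[OF M])
      show "{x. asymp_slope d f x < q} \<in> sets M" using open_asymp_slope_less[OF f] sets by simp
      fix x assume "x \<in> {x. asymp_slope d f x < q}"
      then obtain U where U: "open U" "x \<in> U" "Lip d U f < ennreal q"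
        using asymp_slope_less_iff[OF f \<open>0 < q\<close>] by blast
      obtain g V where g: "g \<in> Lipb d" "Lipb_norm d g \<le> q" "open V" "x \<in> V"
        "\<And>y. y \<in> V \<Longrightarrow> g y = f y - f x"
        using Lipb_localise[OF T f \<open>0 < q\<close> U] by blast
      note fc = Lipb_diff[OF d f Lipb_const[OF d, of "f x"]]
      have "AE y in M. \<bar>b g y\<bar> \<le> W y * Lipb_norm d g"
        using W g(1) by (simp add: Weaver_bounds_def)
      \<comment> \<open>Locality is applied to \<open>f - f x - g\<close>, which vanishes on
        \<open>V\<close>; the constant \<open>f x\<close> disappears under \<open>b\<close>.\<close>
      with Weaver_derivation_local[OF S b Lipb_diff[OF d fc g(1)]]
        derivation_diff[OF d der fc g(1)] derivation_diff[OF d der f Lipb_const[OF d, of "f x"]]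
        derivation_const[OF d der, of "f x"] W_nonneg
      have "AE y in M. y \<in> V \<longrightarrow> \<bar>b f y\<bar> \<le> W y * q"
      proof eventually_elim
        case (elim y)
        show ?case
        proof
          assume "y \<in> V"
          then have "b f y = b g y" using elim g(5) by simp
          moreover have "W y * Lipb_norm d g \<le> W y * q"
            by (rule mult_left_mono[OF g(2)]) (use elim in simp)
          ultimately show "\<bar>b f y\<bar> \<le> W y * q" using elim by simp
        qed
      qed
      with g(3,4) show "\<exists>V. open V \<and> x \<in> V \<and> (AE y in M. y \<in> V \<longrightarrow> \<bar>b f y\<bar> \<le> W y * q)" by blast
    qed
    \<comment> \<open>Rational levels keep the union of the exceptional null sets null, and they
      still approach the slope from strictly above.\<close>
    have "AE y in M. \<forall>q\<in>\<rat> \<inter> {0<..}. asymp_slope d f y < q \<longrightarrow> \<bar>b f y\<bar> \<le> W y * q"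
      by (subst AE_ball_countable) (use level countable_rat in \<open>auto intro: countable_subset\<close>)
    then show ?thesis
    proof eventually_elim
      case (elim y)
      define s where "s = asymp_slope d f y"
      have "\<exists>q. q \<in> \<rat> \<and> s < q \<and> q < s + 1 / Suc n" for n
        using Rats_dense_in_real[of s "s + 1 / Suc n"] by auto
      then obtain q where q: "\<And>n. q n \<in> \<rat>" "\<And>n. s < q n" "\<And>n. q n < s + 1 / Suc n" by metis
      have "q \<longlonglongrightarrow> s"
      proof (rule tendsto_sandwich[of "\<lambda>n. s" _ _ "\<lambda>n. s + 1 / Suc n"])
        show "(\<lambda>n. s + 1 / Suc n) \<longlonglongrightarrow> s"
          using tendsto_add[OF tendsto_const LIMSEQ_Suc[OF lim_1_over_n], of s] by simp
      qed (intro tendsto_const always_eventually allI less_imp_le q)+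
      then have "(\<lambda>n. W y * q n) \<longlonglongrightarrow> W y * s" by (intro tendsto_intros)
      moreover have "\<bar>b f y\<bar> \<le> W y * q n" for n
        using elim q[of n] asymp_slope_nonneg[of d f y] by (auto simp: s_def)
      ultimately show ?case unfolding s_def[symmetric] by (intro LIMSEQ_le_const) auto
    qed
  qed
  then show ?thesis using W_nonneg W_meas by (simp add: slope_bounds_def L0_plus_def W_def)
qed

text \<open>Since the Weaver norm is itself a slope bound, it dominates \<open>Der_norm\<close>,
  which is therefore bounded. Membership in \<open>Der_inf d M\<close> then makes the opposite
  inequality available.\<close>

lemma Weaver_derivations_subset_Der_inf:
  fixes d :: "'a::t2_space \<Rightarrow> 'a \<Rightarrow> ennreal"
  assumes S: "ext_metric_top_measure_space d M" and b: "b \<in> Weaver_derivations d M"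
  shows "b \<in> Der_inf d M" "AE x in M. Weaver_norm d M b x = Der_norm d M b x"
proof -
  have M: "finite_Radon_measure M" using S by (simp add: ext_metric_top_measure_space_def)
  have fin: "finite_measure M" using M by (simp add: finite_Radon_measure_def)
  have der: "Lipschitz_derivation d M b" using b by (simp add: Weaver_derivations_def)
  note W = Weaver_norm_in_slope_bounds[OF S b]
  have "b \<in> Der0 d M" using der W by (auto simp: Der0_def)
  note D = Der_norm_in_slope_bounds[OF M this]
  have "is_ess_inf M (slope_bounds d M b) (Der_norm d M b)"
    by (rule is_ess_inf_Der_norm[OF fin]) (use W in blast)
  then have le: "AE x in M. Der_norm d M b x \<le> Weaver_norm d M b x"
    using W by (simp add: is_ess_inf_def)
  have D_nonneg: "AE x in M. 0 \<le> Der_norm d M b x" and D_meas: "Der_norm d M b \<in> borel_measurable M"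
    using D by (auto simp: slope_bounds_def L0_plus_def)
  obtain C where "AE x in M. \<bar>Weaver_norm d M b x\<bar> \<le> C"
    using Weaver_norm_in_Weaver_bounds[OF fin der Weaver_bounds_nonempty[OF S b]]
    by (auto simp: Weaver_bounds_def Linf_plus_def Linf_def)
  with le D_nonneg have "AE x in M. \<bar>Der_norm d M b x\<bar> \<le> C" by eventually_elim auto
  with D_meas \<open>b \<in> Der0 d M\<close> show bi: "b \<in> Der_inf d M" by (auto simp: Der_inf_def Linf_def)
  show "AE x in M. Weaver_norm d M b x = Der_norm d M b x"
    using le Weaver_norm_le_Der_norm[OF M bi] by eventually_elim auto
qed

theorem theorem4p16:
  fixes d :: "'a::t2_space \<Rightarrow> 'a \<Rightarrow> ennreal" and M :: "'a measure"
  assumes "ext_metric_top_measure_space d M"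
    and "separable_measure M"
  shows "Der_inf_1 d M \<subseteq> Weaver_derivations d M \<and>
    (\<forall>b\<in>Der_inf_1 d M. AE x in M. Weaver_norm d M b x \<le> Der_norm d M b x) \<and>
    ((\<forall>K::'a set. compact K \<longrightarrow> metrizable_space (top_of_set K)) \<longrightarrow>
       Weaver_derivations d M \<subseteq> Der_inf d M \<and>
       (\<forall>b\<in>Weaver_derivations d M. AE x in M. Weaver_norm d M b x = Der_norm d M b x))"
proof -
  have "finite_Radon_measure M" using assms(1) by (simp add: ext_metric_top_measure_space_def)
  then have "AE x in M. Weaver_norm d M b x \<le> Der_norm d M b x" if "b \<in> Der_inf_1 d M" for b
    by (rule Weaver_norm_le_Der_norm) (use that in \<open>simp add: Der_inf_1_def\<close>)
  then show ?thesis
    using Der_inf_1_subset_Weaver_derivations[OF assms(1)]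
      Weaver_derivations_subset_Der_inf[OF assms(1)] by (intro conjI impI subsetI ballI)
qed

end
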